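(* Let $\mathcal F=\{a_1,\dots,a_s\}$ be a finite reduced collection of forbidden words over a symbol set $\Sigma$ of size $q\ge2$ with $\Sigma_{\mathcal F}$ irreducible, let $\mathcal R=\{r_1(m_1),\dots,r_\ell(m_\ell)\}$ be a reduced collection of repeated words, and suppose that $\mathcal F\cup\mathcal R$ is reduced. Let $A$ be the adjacency matrix associated with $\mathcal F$ and $\mathcal R$. Then the Perron root of $A$ is the largest real zero of the rational function $$z-q+z\sum_{i=1}^{\ell}\Bigl(1-\frac1{m_i}\Bigr)R_i(z)-z\sum_{j=1}^{s}R_{\ell+j}(z),$$ which equals $$z-q+z\sum_{i=1}^{\ell}\Bigl(1-\frac1{m_i}\Bigr)S_i(z)-z\sum_{j=1}^{s}S_{\ell+j}(z).$$
   Context: $\Sigma$ is a finite set of $q$ symbols; a word is a finite sequence over $\Sigma$ and $|w|$ is its length. A collection of words is reduced if for any two distinct words in it neither is a (contiguous) subword of the other. $\mathcal F$ is a finite reduced collection of words of length at least $2$; $\Sigma_{\mathcal F}\subseteq\Sigma^{\mathbb N}$ is the set of one-sided sequences containing no word of $\mathcal F$. A word is allowed if it is a subword of some sequence in $\Sigma_{\mathcal F}$; $\mathcal L_n$ is the set of allowed words of length $n$. All symbols are assumed allowed. $\Sigma_{\mathcal F}$ is irreducible: for all allowed $u,v$ there is a word $w$ with $uwv$ allowed. $\mathcal R$ is a finite reduced collection of allowed words $r_1,\dots,r_\ell$, each $r_i$ assigned an integer multiplicity $m_i\ge2$. For an allowed word $w$, $m(w)=\prod_{i}m_i^{n(w;r_i)}$,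 where $n(w;r_i)$ is the number of occurrences of $r_i$ as a subword of $w$ (so the empty word has multiplicity $1$). $p\ge2$ is the length of the longest word in $\mathcal F\cup\mathcal R$. For an allowed word $v=v_1\dots v_n$, $k(v)=m(v)/m(v_2\dots v_n)$. For $X=x_1\dots x_{p-1}$, $Y=y_1\dots y_{p-1}$ in $\mathcal L_{p-1}$, $X*Y$ is defined only if $x_2\dots x_{p-1}=y_1\dots y_{p-2}$ (no condition if $p=2$), and then $X*Y=x_1\dots x_{p-1}y_{p-1}$. The adjacency matrix $A$ associated with $\mathcal F$ and $\mathcal R$ is indexed by $\mathcal L_{p-1}$, with $A_{XY}=k(X*Y)$ if $X*Y$ is defined and lies in $\mathcal L_p$, and $A_{XY}=0$ otherwise. Its Perron root is its largest real (Perron–Frobenius) eigenvalue. Correlation: for words $u,v$, $(u,v)=(c_1,\dots,c_{|u|})$ where $c_i=1$ if, placing $v$ below $u$ so that the leftmost symbol of $v$ lies under the $i$-th symbol of $u$, the overlapping segments are identical, and $c_i=0$ otherwise; $(u,v)_z=\sum_{i=1}^{|u|}c_iz^{|u|-i}$. $P(z)$ is the $(\ell+s)\times(\ell+s)$ matrix $$P(z)_{ij}=\begin{cases}z(1-\frac1{m_j})(r_j,r_i)_z-\delta_{ij}z^{|r_j|}, & 1\le i,j\le\ell,\\ -z(a_{j-\ell},r_i)_z, & i\le\ell<j,\\ z(1-\frac1{m_j})(r_j,a_{i-\ell})_z, & j\le\ell<i,\\ -z(a_{j-\ell},a_{i-\ell})_z, & i,j>\ell,\end{cases}$$ which is invertible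 over the rational functions. $D(z)$ is diagonal with $D_{ii}(z)=z(1-\frac1{m_i})$ for $1\le i\le\ell$ and $D_{ii}(z)=-z$ for $\ell<i\le\ell+s$; $Q=D^{-1}P^TD$. $R_i(z)$ and $S_i(z)$ are the $i$-th row sums of $P^{-1}(z)$ and $Q^{-1}(z)$. *)

theory Defs
  imports
    "HOL-Library.Cardinality"
    "HOL-Library.Sublist"
    "HOL-Computational_Algebra.Polynomial_Factorial"
    "Jordan_Normal_Form.Gauss_Jordan_Elimination"
    "Jordan_Normal_Form.Char_Poly"
begin

(* The alphabet is a finite type 'a; words are lists over it, and contiguous subwords are
   expressed by sublist.  Collections of words are (distinct) lists, since the matrices below
   refer to their numbering; all indices start at 0. *)

definition reduced :: "'a list set \<Rightarrow> bool" where
  "reduced W \<longleftrightarrow> (\<forall>u\<in>W. \<forall>v\<in>W. u \<noteq> v \<longrightarrow> \<not> sublist u v)"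

definition occurs_in_seq :: "'a list \<Rightarrow> (nat \<Rightarrow> 'a) \<Rightarrow> bool" where
  "occurs_in_seq w x \<longleftrightarrow> (\<exists>k. w = map x [k..<k + length w])"

definition shift_space :: "'a list set \<Rightarrow> (nat \<Rightarrow> 'a) set" where
  "shift_space F = {x. \<forall>w\<in>F. \<not> occurs_in_seq w x}"

(* Stronger than merely avoiding F: the word has to appear in an infinite F-free sequence. *)
definition allowed :: "'a list set \<Rightarrow> 'a list \<Rightarrow> bool" where
  "allowed F w \<longleftrightarrow> (\<exists>x\<in>shift_space F. occurs_in_seq w x)"

definition allowed_words :: "'a list set \<Rightarrow> nat \<Rightarrow> 'a list set" where
  "allowed_words F n = {w. allowed F w \<and> length w = n}"

definition irreducible_shift :: "'a list set \<Rightarrow> bool" where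
  "irreducible_shift F \<longleftrightarrow>
     (\<forall>u v. allowed F u \<longrightarrow> allowed F v \<longrightarrow> (\<exists>w. allowed F (u @ w @ v)))"

definition num_occ :: "'a list \<Rightarrow> 'a list \<Rightarrow> nat" where
  "num_occ w r = card {i. i + length r \<le> length w \<and> take (length r) (drop i w) = r}"

definition multiplicity_of :: "'a list list \<Rightarrow> (nat \<Rightarrow> nat) \<Rightarrow> 'a list \<Rightarrow> nat" where
  "multiplicity_of rs m w = (\<Prod>i<length rs. m i ^ num_occ w (rs ! i))"

definition k_weight :: "'a list list \<Rightarrow> (nat \<Rightarrow> nat) \<Rightarrow> 'a list \<Rightarrow> real" where
  "k_weight rs m v = real (multiplicity_of rs m v) / real (multiplicity_of rs m (tl v))"

(* X * Y is defined iff tl X = butlast Y, and then equals X @ [last Y]; for p = 2 both sides of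
   the condition are the empty word. *)
definition adjacency_entry ::
  "'a list list \<Rightarrow> 'a list list \<Rightarrow> (nat \<Rightarrow> nat) \<Rightarrow> nat \<Rightarrow> 'a list \<Rightarrow> 'a list \<Rightarrow> real" where
  "adjacency_entry fs rs m p X Y =
     (if tl X = butlast Y \<and> X @ [last Y] \<in> allowed_words (set fs) p
      then k_weight rs m (X @ [last Y]) else 0)"

(* ws is meant to enumerate the index set allowed_words (set fs) (p - 1). *)
definition adjacency_matrix ::
  "'a list list \<Rightarrow> 'a list list \<Rightarrow> (nat \<Rightarrow> nat) \<Rightarrow> nat \<Rightarrow> 'a list list \<Rightarrow> real mat" where
  "adjacency_matrix fs rs m p ws =
     mat (length ws) (length ws) (\<lambda>(i, j). adjacency_entry fs rs m p (ws ! i) (ws ! j))"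

definition is_greatest :: "real set \<Rightarrow> real \<Rightarrow> bool" where
  "is_greatest S x \<longleftrightarrow> x \<in> S \<and> (\<forall>y\<in>S. y \<le> x)"

definition is_perron_root :: "real mat \<Rightarrow> real \<Rightarrow> bool" where
  "is_perron_root M t \<longleftrightarrow> is_greatest {x. eigenvalue M x} t"

type_synonym ratfun = "real poly fract"

definition Z :: ratfun where
  "Z = to_fract [:0, 1:]"

(* x is a zero iff some representation a/b has b(x) nonzero and a(x) = 0, i.e. the numerator in
   lowest terms vanishes at x; removable singularities are removed, poles are not zeros. *)
definition is_zero_of :: "ratfun \<Rightarrow> real \<Rightarrow> bool" where
  "is_zero_of f x \<longleftrightarrow> (\<exists>a b. f = Fract a b \<and> poly b x \<noteq> 0 \<and> poly a x = 0)"

(* Entry c_(i+1) of the correlation (u, v). *)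
definition corr_bit :: "'a list \<Rightarrow> 'a list \<Rightarrow> nat \<Rightarrow> bool" where
  "corr_bit u v i \<longleftrightarrow> (\<forall>k. i + k < length u \<and> k < length v \<longrightarrow> u ! (i + k) = v ! k)"

definition corr_Z :: "'a list \<Rightarrow> 'a list \<Rightarrow> ratfun" where
  "corr_Z u v = (\<Sum>i<length u. (if corr_bit u v i then 1 else 0) * Z ^ (length u - 1 - i))"

(* The coefficient 1 - 1/m_i. *)
definition defect :: "(nat \<Rightarrow> nat) \<Rightarrow> nat \<Rightarrow> ratfun" where
  "defect m i = 1 - 1 / of_nat (m i)"

definition P_mat :: "'a list list \<Rightarrow> 'a list list \<Rightarrow> (nat \<Rightarrow> nat) \<Rightarrow> ratfun mat" where
  "P_mat fs rs m = (let l = length rs; s = length fs in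
     mat (l + s) (l + s) (\<lambda>(i, j).
       if i < l \<and> j < l then
         Z * defect m j * corr_Z (rs ! j) (rs ! i) - (if i = j then Z ^ length (rs ! j) else 0)
       else if i < l then - Z * corr_Z (fs ! (j - l)) (rs ! i)
       else if j < l then Z * defect m j * corr_Z (rs ! j) (fs ! (i - l))
       else - Z * corr_Z (fs ! (j - l)) (fs ! (i - l))))"

definition D_mat :: "'a list list \<Rightarrow> 'a list list \<Rightarrow> (nat \<Rightarrow> nat) \<Rightarrow> ratfun mat" where
  "D_mat fs rs m = (let l = length rs; s = length fs in
     mat (l + s) (l + s) (\<lambda>(i, j). if i = j then (if i < l then Z * defect m i else - Z) else 0))"

(* Only applied to P, D and Q.  P is invertible because, the words being reduced, the diagonal
   entry strictly dominates the degrees in its column, so mat_inverse does not return None. *)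
definition matinv :: "ratfun mat \<Rightarrow> ratfun mat" where
  "matinv M = the (mat_inverse M)"

definition Q_mat :: "'a list list \<Rightarrow> 'a list list \<Rightarrow> (nat \<Rightarrow> nat) \<Rightarrow> ratfun mat" where
  "Q_mat fs rs m = matinv (D_mat fs rs m) * transpose_mat (P_mat fs rs m) * D_mat fs rs m"

definition row_sum :: "ratfun mat \<Rightarrow> nat \<Rightarrow> ratfun" where
  "row_sum M i = (\<Sum>j<dim_col M. M $$ (i, j))"

definition R_sum :: "'a list list \<Rightarrow> 'a list list \<Rightarrow> (nat \<Rightarrow> nat) \<Rightarrow> nat \<Rightarrow> ratfun" where
  "R_sum fs rs m i = row_sum (matinv (P_mat fs rs m)) i"

definition S_sum :: "'a list list \<Rightarrow> 'a list list \<Rightarrow> (nat \<Rightarrow> nat) \<Rightarrow> nat \<Rightarrow> ratfun" where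
  "S_sum fs rs m i = row_sum (matinv (Q_mat fs rs m)) i"

end

theory Submission
  imports Defs "HOL-Computational_Algebra.Formal_Laurent_Series" "HOL-Computational_Algebra.Field_as_Ring"
begin

unbundle no fps_syntax

text \<open>Let \<open>G\<close> be the power series in \<open>1 / z\<close> that counts the words avoiding \<open>fs\<close>, weighted by their
  multiplicity. Let \<open>U\<^sub>k\<close> count those that end in the \<open>k\<close>-th repeated word, respectively those that
  complete the \<open>k\<close>-th forbidden word with their last symbol. Appending to a word, symbol by symbol,
  a repeated or forbidden word expresses \<open>G\<close> through the \<open>U\<^sub>k\<close>; this is the linear system
  \<open>P U = - G 1\<close>. Appending a single symbol gives one more equation, and eliminating \<open>U\<close> turns it into
  \<open>\<Phi> G = z\<close>.

  On the other hand, up to finitely many terms, \<open>G\<close> is a weighted entry sum of the resolvent of a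
  nonnegative transfer matrix \<open>B\<close> with the same nonzero eigenvalues as \<open>A\<close>, hence a rational function whose poles are eigenvalues of \<open>B\<close> or \<open>0\<close>, so \<open>\<Phi>\<close> has no zero beyond the Perron root \<open>\<theta>\<close>.
  On \<open>t > \<theta>\<close> the resolvent is nonnegative and an eigenvector forces it to blow up at \<open>\<theta>\<close>, so \<open>\<theta>\<close> is
  a pole of \<open>G\<close> and a zero of \<open>\<Phi>\<close>. The equality \<open>\<Phi> = \<Psi>\<close> holds because both sums equal the sum of
  all entries of \<open>D P\<^sup>-\<^sup>1\<close>.\<close>

section \<open>The Perron root of a nonnegative matrix\<close>

text \<open>Keeping the adjugate instead of the inverse of z I - B gives polynomial identities,
  which can be evaluated even at zeros of the characteristic polynomial and mapped into Laurent
  series.\<close>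

lemma adj_char_poly_matrix:
  fixes B :: "'a::field mat"
  assumes B: "B \<in> carrier_mat n n" and i: "i < n" and j: "j < n"
  defines "M \<equiv> adj_mat (char_poly_matrix B)"
  shows "[:0, 1:] * M $$ (i, j) - (\<Sum>k<n. [:B $$ (i, k):] * M $$ (k, j))
           = (if i = j then char_poly B else 0)" (is ?right)
    and "[:0, 1:] * M $$ (i, j) - (\<Sum>k<n. M $$ (i, k) * [:B $$ (k, j):])
           = (if i = j then char_poly B else 0)" (is ?left)
proof -
  let ?C = "char_poly_matrix B"
  have C: "?C \<in> carrier_mat n n" using B by simp
  have M: "M \<in> carrier_mat n n" unfolding M_def using adj_mat(1)[OF C] .
  have Cij: "?C $$ (a, b) = (if a = b then [:0, 1:] else 0) - [:B $$ (a, b):]"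
    if "a < n" "b < n" for a b
    using that B by (auto simp: char_poly_matrix_def)
  have "(?C * M) $$ (i, j) = (\<Sum>k<n. ?C $$ (i, k) * M $$ (k, j))"
    using C M i j by (simp add: scalar_prod_def lessThan_atLeast0)
  also have "\<dots> = (\<Sum>k<n. (if k = i then [:0, 1:] * M $$ (k, j) else 0) - [:B $$ (i, k):] * M $$ (k, j))"
    using i by (intro sum.cong) (auto simp: Cij algebra_simps)
  also have "\<dots> = [:0, 1:] * M $$ (i, j) - (\<Sum>k<n. [:B $$ (i, k):] * M $$ (k, j))"
    using i by (simp add: sum_subtractf)
  finally show ?right
    using adj_mat(2)[OF C, folded M_def] i j by (auto simp: char_poly_def)
  have "(M * ?C) $$ (i, j) = (\<Sum>k<n. M $$ (i, k) * ?C $$ (k, j))"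
    using C M i j by (simp add: scalar_prod_def lessThan_atLeast0)
  also have "\<dots> = (\<Sum>k<n. (if k = j then [:0, 1:] * M $$ (i, k) else 0) - M $$ (i, k) * [:B $$ (k, j):])"
    using j by (intro sum.cong) (auto simp: Cij algebra_simps)
  also have "\<dots> = [:0, 1:] * M $$ (i, j) - (\<Sum>k<n. M $$ (i, k) * [:B $$ (k, j):])"
    using j by (simp add: sum_subtractf)
  finally show ?left
    using adj_mat(3)[OF C, folded M_def] i j by (auto simp: char_poly_def)
qed

text \<open>Minimum principle: at an index \<open>k\<close> where \<open>v k / x k\<close> attains
  its minimum \<open>s\<close>, a negative \<open>s\<close> would turn the strict inequality for
  \<open>x\<close> into \<open>t * v k < t * v k\<close>.\<close>

lemma nonneg_of_strict_supersolution:
  fixes K :: "nat \<Rightarrow> nat \<Rightarrow> real"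
  assumes K: "\<And>i j. i < n \<Longrightarrow> j < n \<Longrightarrow> 0 \<le> K i j"
    and x: "\<And>i. i < n \<Longrightarrow> 0 < x i" "\<And>i. i < n \<Longrightarrow> (\<Sum>j<n. K i j * x j) < t * x i"
    and v: "\<And>i. i < n \<Longrightarrow> (\<Sum>j<n. K i j * v j) \<le> t * v i"
    and i: "i < n"
  shows "0 \<le> v i"
proof -
  define S where "S = (\<lambda>i. v i / x i) ` {..<n}"
  have S: "finite S" "S \<noteq> {}" using i by (auto simp: S_def)
  obtain k where k: "k < n" "Min S = v k / x k"
    using Min_in[OF S] by (auto simp: S_def)
  define s where "s = v k / x k"
  have s: "s * x j \<le> v j" if "j < n" for j
  proof -
    have "s \<le> v j / x j" unfolding s_def k(2)[symmetric] by (rule Min_le) (use S that in \<open>auto simp: S_def\<close>)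
    then show ?thesis using x(1)[OF that] by (simp add: field_simps)
  qed
  have "\<not> s < 0"
  proof
    assume neg: "s < 0"
    have "t * v k = s * (t * x k)" using x(1)[OF k(1)] by (simp add: s_def)
    also have "\<dots> < s * (\<Sum>j<n. K k j * x j)" using x(2)[OF k(1)] neg by simp
    also have "\<dots> = (\<Sum>j<n. K k j * (s * x j))" by (simp add: sum_distrib_left mult_ac)
    also have "\<dots> \<le> (\<Sum>j<n. K k j * v j)"
      by (intro sum_mono mult_left_mono) (auto intro: s K k(1))
    also have "\<dots> \<le> t * v k" by (rule v[OF k(1)])
    finally show False by simp
  qed
  then have "0 \<le> s * x i" using x(1)[OF i] by simp
  with s[OF i] show ?thesis by simp
qed

text \<open>The leading coefficient makes the polynomial positive far out, so a negative value at
  \<open>t\<close> would force a zero beyond \<open>t\<close>.\<close>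

lemma monic_poly_pos:
  fixes p :: "real poly"
  assumes "lead_coeff p > 0" and nz: "\<And>x. \<theta> < x \<Longrightarrow> poly p x \<noteq> 0" and "\<theta> < t"
  shows "poly p t > 0"
proof (rule ccontr)
  assume "\<not> ?thesis"
  then have neg: "poly p t < 0" using nz[OF assms(3)] by linarith
  obtain N where N: "\<And>x. N \<le> x \<Longrightarrow> lead_coeff p \<le> poly p x"
    using poly_pinfty_gt_lc[OF assms(1)] by blast
  have "poly p (max N (t + 1)) > 0" using N[of "max N (t+1)"] assms(1) by simp
  then obtain y where "t < y" "poly p y = 0"
    using poly_IVT_pos[OF _ neg, of "max N (t + 1)"] by (auto simp: less_max_iff_disj)
  then show False using nz[of y] assms(3) by simp
qed

text \<open>The Perron root is the infimum of all \<open>t\<close> admitting a positive vector \<open>x\<close> with \<open>B x < t x\<close>;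
  if the characteristic polynomial did not vanish there, the row sums of the adjugate would form
  such a vector and the infimum could be lowered.\<close>

lemma perron_root_exists:
  fixes B :: "real mat"
  assumes B: "B \<in> carrier_mat n n"
    and nonneg: "\<And>i j. i < n \<Longrightarrow> j < n \<Longrightarrow> 0 \<le> B $$ (i, j)"
    and W: "W \<subseteq> {..<n}" "W \<noteq> {}" "\<And>i. i \<in> W \<Longrightarrow> \<exists>j\<in>W. 1 \<le> B $$ (i, j)"
  obtains \<theta> where "1 \<le> \<theta>" "poly (char_poly B) \<theta> = 0"
    "\<And>t. \<theta> < t \<Longrightarrow> 0 < poly (char_poly B) t"
    "\<And>t i j. \<theta> < t \<Longrightarrow> i < n \<Longrightarrow> j < n \<Longrightarrow> 0 \<le> poly (adj_mat (char_poly_matrix B) $$ (i, j)) t"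
proof -
  define T where "T = {t. \<exists>x. \<forall>i<n. 0 < x i \<and> (\<Sum>j<n. B $$ (i, j) * x j) < t * x i}"
  define \<chi> where "\<chi> = char_poly B"
  define C where "C t i j = poly (adj_mat (char_poly_matrix B) $$ (i, j)) t" for t i j
  have C: "t * C t i j - (\<Sum>k<n. B $$ (i, k) * C t k j) = (if i = j then poly \<chi> t else 0)"
    if "i < n" "j < n" for t i j
    using arg_cong[OF adj_char_poly_matrix(1)[OF B that], of "\<lambda>p. poly p t"]
    by (auto simp: C_def \<chi>_def poly_sum mult.commute split: if_splits)
  have lead: "lead_coeff \<chi> = 1" using degree_monic_char_poly[OF B] by (simp add: \<chi>_def)

  \<comment> \<open>The index set \<open>W\<close> enters here: where \<open>x\<close> is least on
    \<open>W\<close>, one entry of size at least 1 leading back into \<open>W\<close> bounds row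
    \<open>k\<close> of \<open>B x\<close> below by \<open>x k\<close>.\<close>
  have gt1: "1 < t" if "t \<in> T" for t
  proof -
    from that obtain x where x: "\<And>i. i < n \<Longrightarrow> 0 < x i"
      "\<And>i. i < n \<Longrightarrow> (\<Sum>j<n. B $$ (i, j) * x j) < t * x i" by (auto simp: T_def)
    have finW: "finite W" using W(1) finite_subset by blast
    have "Min (x ` W) \<in> x ` W" using finW W(2) by (intro Min_in) auto
    then obtain k where k: "k \<in> W" "Min (x ` W) = x k" by (elim imageE)
    obtain j where j: "j \<in> W" "1 \<le> B $$ (k, j)" using W(3)[OF k(1)] by blast
    have kn: "k < n" and jn: "j < n" using k j W(1) by auto
    have "x k \<le> x j" unfolding k(2)[symmetric] using finW j by simp
    also have "x j \<le> B $$ (k, j) * x j" using j(2) x(1)[OF jn] by simp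
    also have "\<dots> \<le> (\<Sum>j<n. B $$ (k, j) * x j)"
      using jn kn by (intro member_le_sum) (auto intro!: mult_nonneg_nonneg nonneg less_imp_le[OF x(1)])
    also have "\<dots> < t * x k" by (rule x(2)[OF kn])
    finally show ?thesis using x(1)[OF kn] by simp
  qed
  have up: "t' \<in> T" if "t \<in> T" "t \<le> t'" for t t'
  proof -
    from that(1) obtain x where x: "\<forall>i<n. 0 < x i \<and> (\<Sum>j<n. B $$ (i, j) * x j) < t * x i"
      by (auto simp: T_def)
    have "\<forall>i<n. 0 < x i \<and> (\<Sum>j<n. B $$ (i, j) * x j) < t' * x i"
      using x that(2) by (meson less_le_trans less_imp_le mult_right_mono)
    then show ?thesis by (auto simp: T_def)
  qed
  define \<theta> where "\<theta> = Inf T"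
  have "(\<Sum>i<n. \<Sum>j<n. B $$ (i, j)) + 1 \<in> T"
  proof -
    have "(\<Sum>j<n. B $$ (i, j)) \<le> (\<Sum>i<n. \<Sum>j<n. B $$ (i, j))" if "i < n" for i
      using that by (intro member_le_sum[where f="\<lambda>i. \<Sum>j<n. B $$ (i, j)"]) (auto intro!: sum_nonneg nonneg)
    then show ?thesis unfolding T_def by (intro CollectI exI[of _ "\<lambda>_. 1"]) fastforce
  qed
  then have ne: "T \<noteq> {}" by blast
  have bdd: "bdd_below T" using gt1 by (intro bdd_belowI[of _ 1]) (simp add: less_imp_le)
  have \<theta>1: "1 \<le> \<theta>" unfolding \<theta>_def using gt1 by (intro cInf_greatest[OF ne]) (simp add: less_imp_le)
  have above: "t \<in> T" if t: "\<theta> < t" for t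
  proof -
    obtain t' where "t' \<in> T" "t' < t" using t cInf_less_iff[OF ne bdd] by (auto simp: \<theta>_def)
    then show ?thesis using up by auto
  qed

  \<comment> \<open>Beyond \<theta> the minimum principle applies to an eigenvector and to its
    negative, so the eigenvector would vanish.\<close>
  have noroot: "poly \<chi> t \<noteq> 0" if "\<theta> < t" for t
  proof
    assume "poly \<chi> t = 0"
    then have "eigenvalue B t" using eigenvalue_root_char_poly[OF B] by (simp add: \<chi>_def)
    then obtain v where v: "v \<in> carrier_vec n" "v \<noteq> 0\<^sub>v n" "B *\<^sub>v v = t \<cdot>\<^sub>v v"
      using B by (auto simp: eigenvalue_def eigenvector_def)
    have eq: "(\<Sum>j<n. B $$ (i, j) * v $ j) = t * v $ i" if "i < n" for i
      using arg_cong[OF v(3), of "\<lambda>w. vec_index w i"] that B v(1)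
      by (simp add: scalar_prod_def lessThan_atLeast0)
    from above[OF that] obtain x where x: "\<And>i. i < n \<Longrightarrow> 0 < x i"
      "\<And>i. i < n \<Longrightarrow> (\<Sum>j<n. B $$ (i, j) * x j) < t * x i" by (auto simp: T_def)
    have "v $ i = 0" if "i < n" for i
    proof -
      have "0 \<le> v $ i"
        by (rule nonneg_of_strict_supersolution[of n "\<lambda>i j. B $$ (i, j)" x t "\<lambda>i. v $ i"])
          (use nonneg x eq that in auto)
      moreover have "0 \<le> - v $ i"
        by (rule nonneg_of_strict_supersolution[of n "\<lambda>i j. B $$ (i, j)" x t "\<lambda>i. - v $ i"])
          (use nonneg x eq that in \<open>auto simp: sum_negf\<close>)
      ultimately show ?thesis by simp
    qed
    then show False using v(1,2) by (metis eq_vecI carrier_vecD index_zero_vec)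
  qed
  have pos: "0 < poly \<chi> t" if "\<theta> < t" for t
    using monic_poly_pos[OF _ noroot that] lead by simp
  have Cpos: "0 \<le> C t i j" if t: "\<theta> < t" and ij: "i < n" "j < n" for t i j
  proof -
    from above[OF t] obtain x where x: "\<And>i. i < n \<Longrightarrow> 0 < x i"
      "\<And>i. i < n \<Longrightarrow> (\<Sum>j<n. B $$ (i, j) * x j) < t * x i" by (auto simp: T_def)
    have "(\<Sum>k<n. B $$ (i, k) * C t k j) \<le> t * C t i j" if "i < n" for i
      using C[OF that ij(2), of t] pos[OF t] by (auto split: if_splits)
    then show ?thesis
      using nonneg_of_strict_supersolution[of n "\<lambda>i j. B $$ (i, j)" x t "\<lambda>i. C t i j"] nonneg x ij
      by auto
  qed

  have "poly \<chi> \<theta> = 0"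
  proof (rule ccontr)
    assume nz: "poly \<chi> \<theta> \<noteq> 0"
    have lim: "0 \<le> poly r \<theta>" if "\<And>t. \<theta> < t \<Longrightarrow> 0 \<le> poly r t" for r :: "real poly"
    proof -
      have "((\<lambda>t. poly r t) \<longlongrightarrow> poly r \<theta>) (at_right \<theta>)"
        by (intro tendsto_intros)
      moreover have "eventually (\<lambda>t. 0 \<le> poly r t) (at_right \<theta>)"
        using that by (auto simp: eventually_at_filter)
      ultimately show ?thesis by (intro tendsto_lowerbound) auto
    qed
    have \<chi>pos: "0 < poly \<chi> \<theta>" using lim[of \<chi>] pos nz by (simp add: less_le)
    have C\<theta>: "0 \<le> C \<theta> i j" if "i < n" "j < n" for i j
      using lim[of "adj_mat (char_poly_matrix B) $$ (i, j)"] Cpos that by (simp add: C_def)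
    \<comment> \<open>The adjugate applied to the all-ones vector, so that
      \<open>\<theta> x - B x\<close> is the constant vector with value
      \<open>poly \<chi> \<theta>\<close>.\<close>
    define x where "x i = (\<Sum>j<n. C \<theta> i j)" for i
    have x: "(\<Sum>k<n. B $$ (i, k) * x k) + poly \<chi> \<theta> = \<theta> * x i" if i: "i < n" for i
    proof -
      have "(\<Sum>k<n. B $$ (i, k) * x k) = (\<Sum>j<n. \<Sum>k<n. B $$ (i, k) * C \<theta> k j)"
        unfolding x_def sum_distrib_left by (rule sum.swap)
      then have "\<theta> * x i - (\<Sum>k<n. B $$ (i, k) * x k)
          = (\<Sum>j<n. \<theta> * C \<theta> i j - (\<Sum>k<n. B $$ (i, k) * C \<theta> k j))"
        by (simp add: x_def[of i] sum_subtractf sum_distrib_left)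
      also have "\<dots> = (\<Sum>j<n. if i = j then poly \<chi> \<theta> else 0)"
        using C i by (intro sum.cong) auto
      also have "\<dots> = poly \<chi> \<theta>" using i by simp
      finally show ?thesis by simp
    qed
    have x0: "0 \<le> x i" if "i < n" for i unfolding x_def using C\<theta> that by (intro sum_nonneg) auto
    have xpos: "0 < x i" if "i < n" for i
    proof -
      have "0 \<le> (\<Sum>k<n. B $$ (i, k) * x k)" using x0 nonneg that by (intro sum_nonneg mult_nonneg_nonneg) auto
      then have "0 < \<theta> * x i" using x[OF that] \<chi>pos by linarith
      then show ?thesis using \<theta>1 by (simp add: zero_less_mult_iff)
    qed
    define X where "X = (\<Sum>i<n. x i)"
    have xX: "x i \<le> X" if "i < n" for i unfolding X_def using that x0 by (intro member_le_sum) auto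
    have X0: "0 \<le> X" unfolding X_def using x0 by (intro sum_nonneg) auto
    \<comment> \<open>Adding 1 to \<open>X\<close> keeps the denominator positive and makes
      \<open>e * x i < poly \<chi> \<theta>\<close> strict.\<close>
    define e where "e = poly \<chi> \<theta> / (X + 1)"
    have e: "0 < e" using \<chi>pos X0 by (simp add: e_def)
    have "\<theta> - e \<in> T"
    proof -
      have "(\<Sum>k<n. B $$ (i, k) * x k) < (\<theta> - e) * x i" if i: "i < n" for i
      proof -
        have "e * x i \<le> e * X" using xX[OF i] e by simp
        also have "\<dots> < e * (X + 1)" using e by simp
        also have "\<dots> = poly \<chi> \<theta>" using X0 by (simp add: e_def)
        finally show ?thesis using x[OF i] by (simp add: algebra_simps)
      qed
      then show ?thesis using xpos by (auto simp: T_def)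
    qed
    then have "\<theta> \<le> \<theta> - e" unfolding \<theta>_def by (rule cInf_lower[OF _ bdd])
    with e show False by simp
  qed
  then show ?thesis using that[of \<theta>] \<theta>1 pos Cpos by (auto simp: \<chi>_def C_def)
qed

text \<open>Applying the adjugate at \<open>t\<close> to (t - B) v = (t - \<theta>) v gives
  \<chi>(t) v = (t - \<theta>) adj v, which is read off at a coordinate of \<open>v\<close> of
  largest modulus. Where \<chi>(t) is positive, the entry sum of the resolvent is thus at least 1 /
  (t - \<theta>).\<close>

lemma char_poly_le_adj_sum:
  fixes B :: "real mat"
  assumes B: "B \<in> carrier_mat n n" and ev: "eigenvalue B \<theta>" and t: "\<theta> < t"
    and nonneg: "\<And>i j. i < n \<Longrightarrow> j < n \<Longrightarrow> 0 \<le> poly (adj_mat (char_poly_matrix B) $$ (i, j)) t"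
  shows "poly (char_poly B) t
    \<le> (t - \<theta>) * (\<Sum>i<n. \<Sum>j<n. poly (adj_mat (char_poly_matrix B) $$ (i, j)) t)"
proof -
  define \<chi> where "\<chi> = poly (char_poly B) t"
  define C where "C i j = poly (adj_mat (char_poly_matrix B) $$ (i, j)) t" for i j
  have C: "t * C i j - (\<Sum>k<n. C i k * B $$ (k, j)) = (if i = j then \<chi> else 0)"
    if "i < n" "j < n" for i j
    using arg_cong[OF adj_char_poly_matrix(2)[OF B that], of "\<lambda>p. poly p t"]
    by (auto simp: C_def \<chi>_def poly_sum mult.commute split: if_splits)
  obtain v where v: "v \<in> carrier_vec n" "v \<noteq> 0\<^sub>v n" "B *\<^sub>v v = \<theta> \<cdot>\<^sub>v v"
    using ev B by (auto simp: eigenvalue_def eigenvector_def)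
  have eq: "(\<Sum>j<n. B $$ (k, j) * v $ j) = \<theta> * v $ k" if "k < n" for k
    using arg_cong[OF v(3), of "\<lambda>w. vec_index w k"] that B v(1)
    by (simp add: scalar_prod_def lessThan_atLeast0)
  obtain k where k: "k < n" "v $ k \<noteq> 0" using v(1,2) by (metis eq_vecI carrier_vecD index_zero_vec)
  define K where "K = Max ((\<lambda>j. \<bar>v $ j\<bar>) ` {..<n})"
  have le: "\<bar>v $ j\<bar> \<le> K" if "j < n" for j using that by (simp add: K_def)
  have "K \<in> (\<lambda>j. \<bar>v $ j\<bar>) ` {..<n}" unfolding K_def using k by (intro Max_in) auto
  then obtain i where i: "i < n" "\<bar>v $ i\<bar> = K" by auto
  have K: "0 < K" using le[OF k(1)] k(2) by simp
  have "\<chi> * v $ i = (\<Sum>j<n. (if i = j then \<chi> else 0) * v $ j)"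
    using i by (simp add: if_distrib[of "\<lambda>x. x * _"] cong: if_cong)
  also have "\<dots> = (\<Sum>j<n. (t * C i j - (\<Sum>k<n. C i k * B $$ (k, j))) * v $ j)"
    using C i by (intro sum.cong) auto
  also have "\<dots> = (\<Sum>k<n. C i k * (t * v $ k)) - (\<Sum>j<n. \<Sum>k<n. C i k * (B $$ (k, j) * v $ j))"
    by (simp add: algebra_simps sum_subtractf sum_distrib_left sum_distrib_right)
  also have "(\<Sum>j<n. \<Sum>k<n. C i k * (B $$ (k, j) * v $ j)) = (\<Sum>k<n. C i k * (\<theta> * v $ k))"
    by (subst sum.swap) (simp add: eq flip: sum_distrib_left)
  also have "(\<Sum>k<n. C i k * (t * v $ k)) - (\<Sum>k<n. C i k * (\<theta> * v $ k)) = (t - \<theta>) * (\<Sum>k<n. C i k * v $ k)"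
    by (simp add: sum_distrib_left algebra_simps flip: sum_subtractf)
  finally have "\<bar>\<chi>\<bar> * K = (t - \<theta>) * \<bar>\<Sum>k<n. C i k * v $ k\<bar>"
    using i t by (metis abs_mult abs_of_pos diff_gt_0_iff_gt)
  also have "\<bar>\<Sum>k<n. C i k * v $ k\<bar> \<le> (\<Sum>k<n. C i k * K)"
    using nonneg i le by (intro order.trans[OF sum_abs] sum_mono) (auto simp: abs_mult C_def intro!: mult_left_mono)
  also have "\<dots> = (\<Sum>k<n. C i k) * K" by (simp add: sum_distrib_right)
  finally have "\<bar>\<chi>\<bar> * K \<le> (t - \<theta>) * (\<Sum>k<n. C i k) * K" using t by (simp add: mult.assoc)
  then have "\<bar>\<chi>\<bar> \<le> (t - \<theta>) * (\<Sum>k<n. C i k)" using K by simp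
  also have "\<dots> \<le> (t - \<theta>) * (\<Sum>i<n. \<Sum>k<n. C i k)"
    using t nonneg i by (intro mult_left_mono member_le_sum[where f = "\<lambda>i. \<Sum>k<n. C i k"])
      (auto simp: C_def intro!: sum_nonneg)
  finally show ?thesis by (simp add: \<chi>_def C_def)
qed

section \<open>Eigenvectors as functions on a list of words\<close>

lemma sum_nth_distinct: "distinct ws \<Longrightarrow> (\<Sum>i<length ws. h (ws ! i)) = (\<Sum>X\<in>set ws. h X)"
  by (rule sum.reindex_bij_betw) (rule bij_betw_nth, auto)

text \<open>Treating eigenvectors as functions on words makes matrices over different vertex lists
  comparable, by restriction and by extension with 0.\<close>

lemma eigenvalue_mat_list_iff:
  fixes K :: "'b \<Rightarrow> 'b \<Rightarrow> 'c::field"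
  assumes ws: "distinct ws"
  shows "eigenvalue (mat (length ws) (length ws) (\<lambda>(i, j). K (ws ! i) (ws ! j))) y
    \<longleftrightarrow> (\<exists>g. (\<exists>X\<in>set ws. g X \<noteq> 0) \<and> (\<forall>X\<in>set ws. (\<Sum>Y\<in>set ws. K X Y * g Y) = y * g X))"
    (is "eigenvalue ?M y \<longleftrightarrow> (\<exists>g. ?P g)")
proof
  let ?n = "length ws"
  assume "eigenvalue ?M y"
  then obtain v where v: "v \<in> carrier_vec ?n" "v \<noteq> 0\<^sub>v ?n" "?M *\<^sub>v v = y \<cdot>\<^sub>v v"
    by (auto simp: eigenvalue_def eigenvector_def)
  \<comment> \<open>Distinctness leaves at most one index with \<open>ws ! i = X\<close>, so the sum
    inverts the enumeration; off the list it is 0.\<close>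
  define g where "g X = (\<Sum>i<?n. if ws ! i = X then v $ i else 0)" for X
  have g: "g (ws ! i) = v $ i" if "i < ?n" for i
  proof -
    have "g (ws ! i) = (\<Sum>j<?n. if j = i then v $ j else 0)"
      unfolding g_def using ws that by (intro sum.cong) (auto simp: nth_eq_iff_index_eq)
    then show ?thesis using that by simp
  qed
  obtain i where i: "i < ?n" "v $ i \<noteq> 0" using v(1,2) by (metis eq_vecI carrier_vecD index_zero_vec)
  have "(\<Sum>Y\<in>set ws. K X Y * g Y) = y * g X" if X: "X \<in> set ws" for X
  proof -
    obtain i where i: "i < ?n" "ws ! i = X" using X by (auto simp: in_set_conv_nth)
    have "(\<Sum>Y\<in>set ws. K X Y * g Y) = (\<Sum>j<?n. K X (ws ! j) * v $ j)"
      by (simp add: g flip: sum_nth_distinct[OF ws])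
    also have "\<dots> = y * v $ i"
      using arg_cong[OF v(3), of "\<lambda>w. vec_index w i"] i v(1)
      by (simp add: scalar_prod_def lessThan_atLeast0)
    finally show ?thesis using g[OF i(1)] i(2) by simp
  qed
  then show "\<exists>g. ?P g" using g[OF i(1)] i by (metis nth_mem)
next
  let ?n = "length ws"
  assume "\<exists>g. ?P g"
  then obtain g where g: "\<exists>X\<in>set ws. g X \<noteq> 0" "\<forall>X\<in>set ws. (\<Sum>Y\<in>set ws. K X Y * g Y) = y * g X"
    by blast
  define v where "v = vec ?n (\<lambda>i. g (ws ! i))"
  obtain i where "i < ?n" "g (ws ! i) \<noteq> 0" using g(1) by (auto simp: in_set_conv_nth)
  then have "v \<noteq> 0\<^sub>v ?n" by (metis v_def index_vec index_zero_vec(1))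
  moreover have "?M *\<^sub>v v = y \<cdot>\<^sub>v v"
  proof (rule eq_vecI)
    fix i assume "i < dim_vec (y \<cdot>\<^sub>v v)"
    then have i: "i < ?n" by (simp add: v_def)
    have "(?M *\<^sub>v v) $ i = (\<Sum>j<?n. K (ws ! i) (ws ! j) * g (ws ! j))"
      using i by (simp add: v_def scalar_prod_def lessThan_atLeast0)
    also have "\<dots> = y * g (ws ! i)"
      using g(2) i by (simp add: sum_nth_distinct[OF ws, of "\<lambda>Y. K (ws ! i) Y * g Y"])
    finally show "(?M *\<^sub>v v) $ i = (y \<cdot>\<^sub>v v) $ i" using i by (simp add: v_def)
  qed (simp add: v_def)
  ultimately show "eigenvalue ?M y"
    unfolding eigenvalue_def eigenvector_def by (intro exI[of _ v]) (simp add: v_def)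
qed

section \<open>Rational functions as Laurent series at infinity\<close>

interpretation fls_const: inj_comm_ring_hom "fls_const :: real \<Rightarrow> real fls"
  by unfold_locales (auto simp: fls_plus_const)

interpretation fls_const_poly: map_poly_comm_ring_hom "fls_const :: real \<Rightarrow> real fls" ..

text \<open>Substitutes z = 1 / X: the variable X of the word-counting series stands for 1 / z, and
  z becomes \<open>fls_X_inv\<close>.\<close>

definition poly_to_fls :: "real poly \<Rightarrow> real fls" where
  "poly_to_fls r = poly (map_poly fls_const r) fls_X_inv"

interpretation poly_to_fls: comm_ring_hom poly_to_fls
  by unfold_locales (simp_all add: poly_to_fls_def hom_distribs fls_const_poly.hom_mult)

lemma poly_to_fls_pCons: "poly_to_fls (pCons c r) = fls_const c + fls_X_inv * poly_to_fls r"
  by (simp add: poly_to_fls_def hom_distribs)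

lemma poly_to_fls_const: "poly_to_fls [:c:] = fls_const c"
  by (simp add: poly_to_fls_pCons)

text \<open>Distinct powers of \<open>fls_X_inv\<close> occupy distinct positions, so every
  coefficient can be recovered; injectivity follows.\<close>

lemma fls_nth_poly_to_fls: "fls_nth (poly_to_fls r) (- int i) = coeff r i"
proof -
  have "fls_nth (fls_const (coeff r j) * fls_X_inv ^ j) (- int i) = (if j = i then coeff r i else 0)" for j
    by simp
  then show ?thesis
    by (simp add: poly_to_fls_def poly_altdef fls_nth_sum degree_map_poly coeff_map_poly coeff_eq_0)
qed

interpretation poly_to_fls: inj_comm_ring_hom poly_to_fls
proof unfold_locales
  show "r = 0" if "poly_to_fls r = 0" for r
    using that fls_nth_poly_to_fls[of r] by (intro poly_eqI) simp
qed

text \<open>The expansion of a rational function at infinity, in the local parameter \<open>1 / z\<close>.\<close>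

definition expand :: "ratfun \<Rightarrow> real fls" where
  "expand f = poly_to_fls (fst (quot_of_fract f)) / poly_to_fls (snd (quot_of_fract f))"

text \<open>\<open>expand\<close> is defined through one chosen quotient; cross-multiplication shows
  that every other representation gives the same series.\<close>

lemma expand_Fract:
  assumes "b \<noteq> 0"
  shows "expand (Fract a b) = poly_to_fls a / poly_to_fls b"
proof -
  define c d where "c = fst (quot_of_fract (Fract a b))" and "d = snd (quot_of_fract (Fract a b))"
  have d: "d \<noteq> 0" by (simp add: d_def)
  have "Fract a b = Fract c d" by (simp add: c_def d_def)
  then have "a * d = c * b" using assms d by (simp add: eq_fract)
  then have "poly_to_fls a * poly_to_fls d = poly_to_fls c * poly_to_fls b"
    by (metis poly_to_fls.hom_mult)
  then show ?thesis using assms d by (simp add: expand_def c_def[symmetric] d_def[symmetric] field_simps)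
qed

lemma expand_to_fract: "expand (to_fract r) = poly_to_fls r"
  by (simp add: to_fract_def expand_Fract)

text \<open>A homomorphism of fields is injective, so identities of rational functions may be proved
  between their expansions.\<close>

interpretation expand: field_hom expand
proof unfold_locales
  fix f g :: ratfun
  obtain a b where f: "f = Fract a b" "b \<noteq> 0" by (cases f)
  obtain c d where g: "g = Fract c d" "d \<noteq> 0" by (cases g)
  show "expand (f + g) = expand f + expand g" "expand (f * g) = expand f * expand g"
    using f g by (simp_all add: expand_Fract poly_to_fls.hom_add poly_to_fls.hom_mult field_simps)
  show "expand 0 = 0" "expand 1 = 1"
    by (simp_all add: Zero_fract_def One_fract_def expand_Fract)
qed

lemma expand_Z: "expand Z = fls_X_inv"
  by (simp add: Z_def expand_to_fract poly_to_fls_pCons)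

section \<open>Inverse matrices over the rational functions\<close>

lemma matinv_inverse:
  assumes M: "M \<in> carrier_mat n n" and det: "det M \<noteq> 0"
  shows "matinv M \<in> carrier_mat n n" "M * matinv M = 1\<^sub>m n" "matinv M * M = 1\<^sub>m n"
proof -
  \<comment> \<open>A non-zero determinant makes \<open>M\<close> a unit, so
    \<open>mat_inverse\<close> cannot return \<open>None\<close>.\<close>
  obtain N where "mat_inverse M = Some N"
    using mat_inverse(1)[OF M, where b = "()"] det_non_zero_imp_unit[OF M det, of "()"] by (cases "mat_inverse M") auto
  with mat_inverse(2)[OF M this]
  show "matinv M \<in> carrier_mat n n" "M * matinv M = 1\<^sub>m n" "matinv M * M = 1\<^sub>m n"
    by (simp_all add: matinv_def)
qed

lemma matinv_eqI:
  assumes M: "M \<in> carrier_mat n n" and N: "N \<in> carrier_mat n n" and MN: "M * N = 1\<^sub>m n"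
  shows "matinv M = N"
proof -
  have "det M * det N = 1" using det_mult[OF M N] MN by simp
  then have det: "det M \<noteq> 0" by auto
  have "matinv M = matinv M * (M * N)" using MN matinv_inverse(1)[OF M det] by simp
  also have "\<dots> = matinv M * M * N" using M N matinv_inverse(1)[OF M det] by (simp add: assoc_mult_mat)
  also have "\<dots> = N" using matinv_inverse(3)[OF M det] N by simp
  finally show ?thesis .
qed

text \<open>Inversion commutes with transposition and with conjugation by \<open>D\<close>; this
  names the candidate inverse, and multiplying out confirms it.\<close>

lemma matinv_diag_conjugate_transpose:
  fixes M :: "ratfun mat" and d :: "nat \<Rightarrow> ratfun"
  assumes M: "M \<in> carrier_mat n n" and det: "det M \<noteq> 0" and d: "\<And>i. i < n \<Longrightarrow> d i \<noteq> 0"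
  defines "D \<equiv> mat n n (\<lambda>(i, j). if i = j then d i else 0)"
  shows "matinv (matinv D * transpose_mat M * D) = mat n n (\<lambda>(i, j). matinv M $$ (j, i) * d j / d i)"
proof -
  define D' where "D' = mat n n (\<lambda>(i, j). if i = j then 1 / d i else 0)"
  have "D * D' = 1\<^sub>m n"
  proof (rule eq_matI)
    fix i j assume "i < dim_row (1\<^sub>m n)" "j < dim_col (1\<^sub>m n)"
    then have ij: "i < n" "j < n" by auto
    have "(D * D') $$ (i, j) = (\<Sum>k<n. (if i = k then d i else 0) * (if k = j then 1 / d k else 0))"
      using ij by (simp add: D_def D'_def scalar_prod_def lessThan_atLeast0)
    also have "\<dots> = (\<Sum>k<n. if k = i then d i * (if k = j then 1 / d k else 0) else 0)"
      by (intro sum.cong) auto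
    also have "\<dots> = 1\<^sub>m n $$ (i, j)" using ij d by simp
    finally show "(D * D') $$ (i, j) = 1\<^sub>m n $$ (i, j)" .
  qed (auto simp: D_def D'_def)
  then have D': "matinv D = D'" by (intro matinv_eqI[of _ n]) (auto simp: D_def D'_def)
  have MD: "(D' * transpose_mat M * D) $$ (i, j) = M $$ (j, i) * d j / d i" if ij: "i < n" "j < n" for i j
  proof -
    have *: "(D' * transpose_mat M) $$ (i, k) = M $$ (k, i) / d i" if "k < n" for k
    proof -
      have "(D' * transpose_mat M) $$ (i, k) = (\<Sum>l<n. (if i = l then 1 / d i else 0) * M $$ (k, l))"
        using ij that M by (simp add: D'_def scalar_prod_def lessThan_atLeast0)
      also have "\<dots> = (\<Sum>l<n. if l = i then 1 / d i * M $$ (k, l) else 0)"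
        by (intro sum.cong) auto
      finally show ?thesis using ij by simp
    qed
    have "(D' * transpose_mat M * D) $$ (i, j) = (\<Sum>k<n. (D' * transpose_mat M) $$ (i, k) * D $$ (k, j))"
      using ij M by (simp add: D_def D'_def scalar_prod_def lessThan_atLeast0)
    also have "\<dots> = (\<Sum>k<n. M $$ (k, i) / d i * (if k = j then d k else 0))"
      using ij by (intro sum.cong) (auto simp: * D_def)
    also have "\<dots> = (\<Sum>k<n. if k = j then M $$ (k, i) / d i * d k else 0)"
      by (intro sum.cong) auto
    finally show ?thesis using ij by simp
  qed
  let ?Y = "mat n n (\<lambda>(i, j). matinv M $$ (j, i) * d j / d i)"
  note inv = matinv_inverse[OF M det]
  have "(D' * transpose_mat M * D) * ?Y = 1\<^sub>m n"
  proof (rule eq_matI)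
    fix i j assume "i < dim_row (1\<^sub>m n)" "j < dim_col (1\<^sub>m n)"
    then have ij: "i < n" "j < n" by auto
    have "(D' * transpose_mat M * D * ?Y) $$ (i, j)
        = (\<Sum>k<n. (D' * transpose_mat M * D) $$ (i, k) * ?Y $$ (k, j))"
      using ij M by (simp add: D_def D'_def scalar_prod_def lessThan_atLeast0)
    also have "\<dots> = (\<Sum>k<n. (d j / d i) * (matinv M $$ (j, k) * M $$ (k, i)))"
      using ij d by (intro sum.cong) (auto simp: MD)
    also have "\<dots> = d j / d i * (matinv M * M) $$ (j, i)"
      using ij M inv(1) by (simp add: sum_distrib_left scalar_prod_def lessThan_atLeast0)
    also have "\<dots> = 1\<^sub>m n $$ (i, j)" using ij d inv(3) by auto
    finally show "(D' * transpose_mat M * D * ?Y) $$ (i, j) = 1\<^sub>m n $$ (i, j)" .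
  qed (use M in \<open>auto simp: D_def D'_def\<close>)
  then show ?thesis unfolding D' by (intro matinv_eqI[of _ n]) (use M in \<open>auto simp: D_def D'_def\<close>)
qed

interpretation fps_to_fls: inj_comm_ring_hom "fps_to_fls :: real fps \<Rightarrow> real fls"
  by unfold_locales (auto simp: fls_times_fps_to_fls)

text \<open>Multiplying column \<open>j\<close> by X^(e j) yields power series whose constant terms
  form an invertible diagonal matrix. Taking constant terms commutes with determinants, so the
  scaled determinant is non-zero, and it is a multiple of the expansion of
  \<open>det M\<close>.\<close>

lemma det_expand_nonzero:
  fixes M :: "ratfun mat"
  assumes M: "M \<in> carrier_mat n n" and c: "\<And>i. i < n \<Longrightarrow> c i \<noteq> 0"
    and N: "\<And>i j. i < n \<Longrightarrow> j < n \<Longrightarrow> expand (M $$ (i, j)) * fls_X ^ e j = fps_to_fls (N i j)"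
    and N0: "\<And>i j. i < n \<Longrightarrow> j < n \<Longrightarrow> fps_nth (N i j) 0 = (if i = j then c i else 0)"
  shows "det M \<noteq> 0"
proof -
  interpret F0: comm_ring_hom "\<lambda>f :: real fps. fps_nth f 0"
    by unfold_locales auto
  define NN where "NN = mat n n (\<lambda>(i, j). N i j)"
  define E where "E = mat n n (\<lambda>(i, j). if i = j then fls_X ^ e i else (0 :: real fls))"
  let ?N0 = "map_mat (\<lambda>f. fps_nth f 0) NN"
  let ?C = "mat n n (\<lambda>(i, j). if i = j then c i else 0)"
  have "?N0 = ?C"
    by (rule eq_matI) (auto simp: NN_def N0)
  moreover have "det ?C = prod_list (diag_mat ?C)"
    by (rule det_upper_triangular[of _ n]) (auto simp: upper_triangular_def)
  ultimately have "det ?N0 = prod_list (diag_mat ?C)" by simp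
  also have "\<dots> \<noteq> 0" using c by (auto simp: diag_mat_def prod_list_zero_iff)
  finally have nz: "det NN \<noteq> 0" using F0.hom_det[of NN] by auto
  have "map_mat expand M * E = map_mat fps_to_fls NN"
  proof (rule eq_matI)
    fix i j assume "i < dim_row (map_mat fps_to_fls NN)" "j < dim_col (map_mat fps_to_fls NN)"
    then have ij: "i < n" "j < n" by (auto simp: NN_def)
    have "(map_mat expand M * E) $$ (i, j)
        = (\<Sum>k<n. expand (M $$ (i, k)) * (if k = j then fls_X ^ e k else 0))"
      using ij M by (simp add: E_def scalar_prod_def lessThan_atLeast0)
    also have "\<dots> = (\<Sum>k<n. if k = j then expand (M $$ (i, k)) * fls_X ^ e k else 0)"
      by (intro sum.cong) auto
    finally have "(map_mat expand M * E) $$ (i, j) = expand (M $$ (i, j)) * fls_X ^ e j"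
      using ij by simp
    then show "(map_mat expand M * E) $$ (i, j) = map_mat fps_to_fls NN $$ (i, j)"
      using ij N by (simp add: NN_def)
  qed (use M in \<open>auto simp: NN_def E_def\<close>)
  then have "expand (det M) * det E = fps_to_fls (det NN)"
    using det_mult[of "map_mat expand M" n E] M by (simp add: E_def)
  with nz show ?thesis by auto
qed

text \<open>All equations share one right-hand side, so applying the inverse matrix involves only
  its row sums; this is how they enter the theorem.\<close>

lemma solve_by_row_sums:
  fixes M :: "ratfun mat" and u :: "nat \<Rightarrow> real fls"
  assumes M: "M \<in> carrier_mat n n" and det: "det M \<noteq> 0"
    and u: "\<And>i. i < n \<Longrightarrow> (\<Sum>j<n. expand (M $$ (i, j)) * u j) = - G"
    and k: "k < n"
  shows "u k = - expand (row_sum (matinv M) k) * G"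
proof -
  note inv = matinv_inverse[OF M det]
  have id: "(\<Sum>i<n. matinv M $$ (k, i) * M $$ (i, j)) = (if k = j then 1 else 0)" if "j < n" for j
    using arg_cong[OF inv(3), of "\<lambda>A. A $$ (k, j)"] that k M inv(1)
    by (simp add: scalar_prod_def lessThan_atLeast0)
  have "- expand (row_sum (matinv M) k) * G = (\<Sum>i<n. expand (matinv M $$ (k, i)) * (\<Sum>j<n. expand (M $$ (i, j)) * u j))"
    using inv(1) u by (simp add: row_sum_def expand.hom_sum sum_distrib_right sum_negf)
  also have "\<dots> = (\<Sum>i<n. \<Sum>j<n. expand (matinv M $$ (k, i) * M $$ (i, j)) * u j)"
    by (simp add: sum_distrib_left expand.hom_mult mult.assoc)
  also have "\<dots> = (\<Sum>j<n. expand (\<Sum>i<n. matinv M $$ (k, i) * M $$ (i, j)) * u j)"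
    by (subst sum.swap) (simp add: expand.hom_sum sum_distrib_right)
  also have "\<dots> = (\<Sum>j<n. if j = k then u j else 0)"
    by (intro sum.cong) (auto simp: id)
  also have "\<dots> = u k" using k by simp
  finally show ?thesis by simp
qed

text \<open>Multiplied by the square of the numerator \<open>a\<close> of \<open>f\<close>, the bound on \<open>\<chi>\<close> becomes
  \<open>t a(t)\<^sup>2 \<le> (t - \<theta>) a(t) t\<^sup>k b(t)\<close>, where \<open>t \<rightarrow> \<theta>\<close> leaves \<open>a(\<theta>) = 0\<close>.\<close>

lemma is_greatest_zeroI:
  assumes eq: "f * to_fract c = Z ^ k * to_fract \<chi>"
    and \<theta>: "1 \<le> \<theta>"
    and pos: "\<And>t. \<theta> < t \<Longrightarrow> 0 < poly \<chi> t"
    and le: "\<And>t. \<theta> < t \<Longrightarrow> t * poly \<chi> t \<le> (t - \<theta>) * poly c t"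
  shows "is_greatest {x. is_zero_of f x} \<theta>"
proof -
  \<comment> \<open>Clearing denominators gives a polynomial identity for every representation a / b
    of \<open>f\<close>, valid also at points where b vanishes.\<close>
  have cross: "poly a t * poly c t = t ^ k * poly \<chi> t * poly b t"
    if ab: "f = Fract a b" "b \<noteq> 0" for a b t
  proof -
    have Zk: "Z ^ k = to_fract ([:0, 1:] ^ k)" by (induction k) (simp_all add: Z_def del: mult_pCons_left)
    have "to_fract a = f * to_fract b" using ab by (simp add: Fract_conv_to_fract)
    then have "to_fract (a * c) = (f * to_fract c) * to_fract b" by (simp add: mult_ac)
    also have "\<dots> = to_fract ([:0, 1:] ^ k * \<chi> * b)" unfolding eq Zk by simp
    finally have "to_fract (a * c) = to_fract ([:0, 1:] ^ k * \<chi> * b)" .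
    then have "a * c = [:0, 1:] ^ k * \<chi> * b" by (simp only: to_fract_eq_iff)
    from arg_cong[OF this, of "\<lambda>p. poly p t"] show ?thesis by simp
  qed
  define a b where "a = fst (quot_of_fract f)" and "b = snd (quot_of_fract f)"
  have ab: "f = Fract a b" "b \<noteq> 0" by (simp_all add: a_def b_def)
  have "\<theta> * (poly a \<theta>)\<^sup>2 \<le> (\<theta> - \<theta>) * (poly a \<theta> * \<theta> ^ k * poly b \<theta>)"
  proof (rule tendsto_le)
    show "((\<lambda>t. t * (poly a t)\<^sup>2) \<longlongrightarrow> \<theta> * (poly a \<theta>)\<^sup>2) (at_right \<theta>)"
      and "((\<lambda>t. (t - \<theta>) * (poly a t * t ^ k * poly b t))
          \<longlongrightarrow> (\<theta> - \<theta>) * (poly a \<theta> * \<theta> ^ k * poly b \<theta>)) (at_right \<theta>)"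
      by (intro tendsto_intros)+
    have "t * (poly a t)\<^sup>2 \<le> (t - \<theta>) * (poly a t * t ^ k * poly b t)" if t: "\<theta> < t" for t
    proof -
      have "t * poly \<chi> t * (poly a t)\<^sup>2 \<le> (t - \<theta>) * poly c t * (poly a t)\<^sup>2"
        using le[OF t] by (rule mult_right_mono) simp
      also have "\<dots> = (t - \<theta>) * poly a t * (poly a t * poly c t)"
        by (simp add: power2_eq_square)
      also have "\<dots> = (t - \<theta>) * (poly a t * t ^ k * poly b t) * poly \<chi> t"
        unfolding cross[OF ab] by (simp add: mult_ac)
      finally have "t * (poly a t)\<^sup>2 * poly \<chi> t \<le> (t - \<theta>) * (poly a t * t ^ k * poly b t) * poly \<chi> t"
        by (simp add: mult_ac)
      then show ?thesis using pos[OF t] by simp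
    qed
    then show "\<forall>\<^sub>F t in at_right \<theta>. t * (poly a t)\<^sup>2 \<le> (t - \<theta>) * (poly a t * t ^ k * poly b t)"
      by (auto simp: eventually_at_filter)
  qed simp
  then have "\<theta> * (poly a \<theta>)\<^sup>2 \<le> 0" by simp
  then have a0: "poly a \<theta> = 0" using \<theta> by (simp add: mult_le_0_iff)
  \<comment> \<open>The quotient is in lowest terms, so \<theta> is not a common root.\<close>
  have "poly b \<theta> \<noteq> 0"
  proof
    assume "poly b \<theta> = 0"
    then have "[:-\<theta>, 1:] dvd a" "[:-\<theta>, 1:] dvd b" using a0 by (simp_all add: poly_eq_0_iff_dvd)
    then have "is_unit [:-\<theta>, 1:]" using coprime_quot_of_fract[of f] unfolding a_def b_def
      by (meson coprime_def)
    then show False by (simp add: is_unit_pCons_iff)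
  qed
  then have "is_zero_of f \<theta>" using ab a0 unfolding is_zero_of_def by blast
  \<comment> \<open>A zero \<open>y\<close> beyond \<theta> would annihilate the left side of
    \<open>cross\<close>, while all three factors on the right are non-zero there.\<close>
  moreover have "y \<le> \<theta>" if zero: "is_zero_of f y" for y
  proof (rule ccontr)
    assume "\<not> y \<le> \<theta>"
    then have y: "\<theta> < y" by simp
    obtain a b where ab: "f = Fract a b" "poly b y \<noteq> 0" "poly a y = 0"
      using zero by (auto simp: is_zero_of_def)
    then have "b \<noteq> 0" by auto
    from cross[OF ab(1) this, of y] ab(2,3) pos[OF y] y \<theta> show False by simp
  qed
  ultimately show ?thesis by (auto simp: is_greatest_def)
qed

section \<open>Words and generating functions\<close>

lemma num_occ_snoc:
  assumes r: "r \<noteq> []"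
  shows "num_occ (w @ [c]) r = num_occ w r + (if suffix r (w @ [c]) then 1 else 0)"
proof -
  define S where "S = {i. i + length r \<le> length w \<and> take (length r) (drop i w) = r}"
  \<comment> \<open>The start of the only occurrence that can be new. If \<open>r\<close> is longer
    than \<open>w @ [c]\<close>, truncated subtraction gives 0 and the suffix condition
    fails.\<close>
  define k where "k = length w + 1 - length r"
  have fin: "finite S" unfolding S_def by (rule finite_subset[of _ "{..length w}"]) auto
  have suf: "suffix r (w @ [c]) \<longleftrightarrow> length r \<le> length w + 1 \<and> drop k (w @ [c]) = r"
  proof
    assume "suffix r (w @ [c])"
    then obtain z where z: "w @ [c] = z @ r" by (auto simp: suffix_def)
    have "length w + 1 = length z + length r" using arg_cong[OF z, of length] by simp
    then show "length r \<le> length w + 1 \<and> drop k (w @ [c]) = r" unfolding k_def z by simp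
  next
    assume "length r \<le> length w + 1 \<and> drop k (w @ [c]) = r"
    then show "suffix r (w @ [c])" by (metis suffix_drop)
  qed
  have "{i. i + length r \<le> length (w @ [c]) \<and> take (length r) (drop i (w @ [c])) = r}
      = S \<union> (if suffix r (w @ [c]) then {k} else {})" (is "?L = _")
  proof (rule Set.set_eqI)
    fix i
    consider "i + length r \<le> length w" | "i + length r = length w + 1" | "i + length r > length w + 1"
      by linarith
    then show "i \<in> ?L \<longleftrightarrow> i \<in> S \<union> (if suffix r (w @ [c]) then {k} else {})"
    proof cases
      case 1
      then show ?thesis by (auto simp: S_def k_def)
    next
      case 2
      then have "i = k" by (simp add: k_def)
      moreover have "i \<notin> S" using 2 by (simp add: S_def)
      moreover have "take (length r) (drop i (w @ [c])) = drop i (w @ [c])" using 2 by simp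
      ultimately show ?thesis using 2 suf by auto
    next
      case 3
      then show ?thesis using suf by (auto simp: S_def k_def)
    qed
  qed
  moreover have "k \<notin> S" using r by (cases r) (auto simp: S_def k_def)
  ultimately show ?thesis using fin by (simp add: num_occ_def S_def[symmetric])
qed

lemma num_occ_Cons:
  "num_occ (c # w) r = num_occ w r + (if prefix r (c # w) then 1 else 0)"
proof -
  define S where "S = {i. i + length r \<le> length w \<and> take (length r) (drop i w) = r}"
  have fin: "finite S" unfolding S_def by (rule finite_subset[of _ "{..length w}"]) auto
  have pre: "prefix r (c # w) \<longleftrightarrow> length r \<le> length (c # w) \<and> take (length r) (c # w) = r"
    by (metis prefix_def append_eq_conv_conj prefix_length_le take_is_prefix)
  have "{i. i + length r \<le> length (c # w) \<and> take (length r) (drop i (c # w)) = r}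
      = Suc ` S \<union> (if prefix r (c # w) then {0} else {})" (is "?L = _")
  proof -
    have "i \<in> ?L \<longleftrightarrow> i \<in> Suc ` S \<union> (if prefix r (c # w) then {0} else {})" for i
      using pre by (cases i) (auto simp: S_def)
    then show ?thesis by (intro Set.set_eqI)
  qed
  moreover have "0 \<notin> Suc ` S" by auto
  ultimately show ?thesis using fin by (simp add: num_occ_def S_def[symmetric] card_image)
qed

lemma sublist_snoc:
  "sublist u (w @ [c]) \<longleftrightarrow> suffix u (w @ [c]) \<or> sublist u w"
proof -
  have "sublist (rev u) (c # rev w) \<longleftrightarrow> prefix (rev u) (c # rev w) \<or> sublist (rev u) (rev w)"
    by (rule sublist_Cons_right)
  then show ?thesis by (metis rev.simps(2) rev_rev_ident sublist_rev suffix_to_prefix)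
qed

section \<open>Words of fixed length and their generating functions\<close>

definition words :: "nat \<Rightarrow> 'a list set" where
  "words n = {w. length w = n}"

lemma finite_words [simp, intro]: "finite (words n :: 'a::finite list set)"
  using finite_lists_length_eq[of "UNIV :: 'a set" n] by (simp add: words_def)

lemma words_0 [simp]: "words 0 = {[]}"
  by (auto simp: words_def)

lemma sum_words_snoc:
  fixes h :: "'a::finite list \<Rightarrow> real"
  shows "(\<Sum>u\<in>words (Suc n). h u) = (\<Sum>w\<in>words n. \<Sum>c\<in>UNIV. h (w @ [c]))"
proof -
  have "(\<Sum>w\<in>words n. \<Sum>c\<in>UNIV. h (w @ [c])) = (\<Sum>(w, c)\<in>words n \<times> UNIV. h (w @ [c]))"
    by (simp add: sum.cartesian_product)
  also have "\<dots> = (\<Sum>u\<in>words (Suc n). h u)"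
    by (rule sum.reindex_bij_witness[of _ "\<lambda>u. (butlast u, last u)" "\<lambda>(w, c). w @ [c]"])
      (auto simp: words_def snoc_eq_iff_butlast)
  finally show ?thesis by simp
qed

lemma sum_words_Cons:
  fixes h :: "'a::finite list \<Rightarrow> real"
  shows "(\<Sum>u\<in>words (Suc n). h u) = (\<Sum>c\<in>UNIV. \<Sum>w\<in>words n. h (c # w))"
proof -
  have "(\<Sum>c\<in>UNIV. \<Sum>w\<in>words n. h (c # w)) = (\<Sum>(c, w)\<in>UNIV \<times> words n. h (c # w))"
    by (simp add: sum.cartesian_product)
  also have "\<dots> = (\<Sum>u\<in>words (Suc n). h u)"
    by (rule sum.reindex_bij_witness[of _ "\<lambda>u. (hd u, tl u)" "\<lambda>(c, w). c # w"])
      (auto simp: words_def length_Suc_conv)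
  finally show ?thesis by simp
qed

definition gf :: "('a::finite list \<Rightarrow> real) \<Rightarrow> real fps" where
  "gf h = Abs_fps (\<lambda>n. \<Sum>w\<in>words n. h w)"

lemma gf_nth: "fps_nth (gf h) n = (\<Sum>w\<in>words n. h w)"
  by (simp add: gf_def)

lemma gf_diff: "gf (\<lambda>w. g w - h w) = gf g - gf h"
  by (rule fps_ext) (simp add: gf_nth sum_subtractf)

lemma gf_sum: "gf (\<lambda>w. \<Sum>i\<in>I. c i * h i w) = (\<Sum>i\<in>I. fps_const (c i) * gf (h i))"
  by (rule fps_ext) (simp add: gf_nth fps_sum_nth sum_distrib_left sum.swap[of _ I])

text \<open>For \<open>|s| \<le> |r|\<close> a word \<open>w s\<close> can end in \<open>r\<close> only if \<open>s\<close> is a suffix of \<open>r\<close>; in that case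
  the words \<open>w s\<close> ending in \<open>r\<close> are all the words ending in \<open>r\<close>.\<close>

lemma gf_append_suffix:
  assumes len: "length s \<le> length r"
  shows "fps_X ^ length s * gf (\<lambda>w. if suffix r (w @ s) then h (w @ s) else 0)
       = (if suffix s r then gf (\<lambda>u. if suffix r u then h u else 0) else 0)"
proof (cases "suffix s r")
  case False
  have "\<not> suffix r (w @ s)" for w
    using False len suffix_length_suffix[of s "w @ s" r] by (auto simp: suffixI)
  then have "gf (\<lambda>w. if suffix r (w @ s) then h (w @ s) else 0) = 0"
    by (intro fps_ext) (simp add: gf_nth)
  then show ?thesis using False by simp
next
  case True
  show ?thesis
  proof (rule fps_ext)
    fix n
    show "fps_nth (fps_X ^ length s * gf (\<lambda>w. if suffix r (w @ s) then h (w @ s) else 0)) n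
       = fps_nth (if suffix s r then gf (\<lambda>u. if suffix r u then h u else 0) else 0) n"
    proof (cases "n < length s")
      case n: True
      have "\<not> suffix r u" if "u \<in> words n" for u
        using that n len suffix_length_le[of r u] by (auto simp: words_def)
      then have "(\<Sum>u\<in>words n. if suffix r u then h u else 0) = 0"
        by (intro sum.neutral) auto
      then show ?thesis using n True by (simp add: fps_X_power_mult_nth gf_nth)
    next
      case False
      define k where "k = n - length s"
      have n: "n = k + length s" using False by (simp add: k_def)
      have "(\<Sum>u\<in>words n. if suffix r u then h u else 0)
          = (\<Sum>u\<in>(\<lambda>w. w @ s) ` words k. if suffix r u then h u else 0)"
      proof (rule sum.mono_neutral_right)
        show "(\<lambda>w. w @ s) ` words k \<subseteq> words n" by (auto simp: words_def n)
        show "\<forall>u\<in>words n - (\<lambda>w. w @ s) ` words k. (if suffix r u then h u else 0) = 0"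
        proof
          fix u assume u: "u \<in> words n - (\<lambda>w. w @ s) ` words k"
          have "\<not> suffix r u"
          proof
            assume "suffix r u"
            then have "suffix s u" using True suffix_order.trans by blast
            then obtain w where "u = w @ s" by (auto simp: suffix_def)
            with u show False by (auto simp: words_def n)
          qed
          then show "(if suffix r u then h u else 0) = 0" by simp
        qed
      qed auto
      also have "\<dots> = (\<Sum>w\<in>words k. if suffix r (w @ s) then h (w @ s) else 0)"
        by (subst sum.reindex) (auto simp: inj_on_def)
      finally show ?thesis using False True by (simp add: fps_X_power_mult_nth gf_nth k_def)
    qed
  qed
qed

section \<open>Weights of words and their change under one more symbol\<close>

locale word_system =
  fixes fs rs :: "'a::finite list list" and m :: "nat \<Rightarrow> nat"
  assumes distinct_words: "distinct (rs @ fs)"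
    and reduced_words: "reduced (set (rs @ fs))"
    and nonempty_words: "[] \<notin> set (rs @ fs)"
    and mult_ge_2: "i < length rs \<Longrightarrow> 2 \<le> m i"
begin

declare suffix_snoc [simp del]

abbreviation "l \<equiv> length rs"
abbreviation "N \<equiv> length (rs @ fs)"
text \<open>Repeated words come first, so the numbering agrees with the rows and columns of P:
  \<open>k < l\<close> is a repeated word, \<open>l \<le> k < N\<close> a forbidden one.\<close>

abbreviation "W k \<equiv> (rs @ fs) ! k"

text \<open>Weaker than \<open>allowed\<close>: a free word need not extend to an infinite sequence
  avoiding \<open>fs\<close>. Being free can be checked symbol by symbol;
  \<open>eigenvalue_B_iff\<close> accounts for the surplus words.\<close>

definition free :: "'a list \<Rightarrow> bool" where
  "free w \<longleftrightarrow> (\<forall>a\<in>set fs. \<not> sublist a w)"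

definition weight :: "'a list \<Rightarrow> real" where
  "weight w = (if free w then real (multiplicity_of rs m w) else 0)"

text \<open>Completing a repeated word multiplies the weight by \<open>m k\<close>, an increment of
  1 - 1 / m_k times the new weight; completing a forbidden word loses the whole old weight.\<close>

definition coef :: "nat \<Rightarrow> real" where
  "coef k = (if k < l then 1 - 1 / real (m k) else -1)"

text \<open>A word ending in a forbidden word has weight 0, so the weight before its last symbol is
  recorded instead.\<close>

definition end_weight :: "nat \<Rightarrow> 'a list \<Rightarrow> real" where
  "end_weight k u = (if k < l then weight u else weight (butlast u))"

definition end_gf :: "nat \<Rightarrow> real fps" where
  "end_gf k = gf (\<lambda>u. if suffix (W k) u then end_weight k u else 0)"

lemma mult_pos: "i < l \<Longrightarrow> 0 < m i"
  using mult_ge_2 by fastforce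

lemma W_nonempty: "k < N \<Longrightarrow> W k \<noteq> []"
  using nonempty_words nth_mem by metis

lemma sublist_W_eq: "\<lbrakk>i < N; j < N; sublist (W i) (W j)\<rbrakk> \<Longrightarrow> i = j"
  using reduced_words distinct_words unfolding reduced_def by (metis nth_mem nth_eq_iff_index_eq)

lemma suffix_W_unique:
  assumes "i < N" "j < N" "suffix (W i) u" "suffix (W j) u"
  shows "i = j"
  using suffix_same_cases[OF assms(3,4)] sublist_W_eq assms(1,2) suffix_imp_sublist by metis

lemma free_Nil: "free []"
  using nonempty_words by (auto simp: free_def)

lemma free_sublist: "\<lbrakk>free w; sublist u w\<rbrakk> \<Longrightarrow> free u"
  using sublist_order.order.trans by (auto simp: free_def)

lemma free_snoc: "free (w @ [c]) \<longleftrightarrow> free w \<and> (\<forall>k<N. l \<le> k \<longrightarrow> \<not> suffix (W k) (w @ [c]))"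
proof -
  have "(\<forall>a\<in>set fs. \<not> suffix a (w @ [c])) \<longleftrightarrow> (\<forall>k<N. l \<le> k \<longrightarrow> \<not> suffix (W k) (w @ [c]))"
  proof
    assume *: "\<forall>k<N. l \<le> k \<longrightarrow> \<not> suffix (W k) (w @ [c])"
    show "\<forall>a\<in>set fs. \<not> suffix a (w @ [c])"
    proof
      fix a assume "a \<in> set fs"
      then obtain j where "j < length fs" "fs ! j = a" by (auto simp: in_set_conv_nth)
      then show "\<not> suffix a (w @ [c])" using *[rule_format, of "l + j"] by (simp add: nth_append)
    qed
  qed (auto simp: nth_append)
  then show ?thesis by (auto simp: free_def sublist_snoc)
qed

lemma multiplicity_Nil: "multiplicity_of rs m [] = 1"
proof -
  have "num_occ [] (rs ! i) = 0" if "i < l" for i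
    using W_nonempty[of i] that by (auto simp: num_occ_def nth_append)
  then show ?thesis by (simp add: multiplicity_of_def)
qed

lemma multiplicity_snoc:
  "multiplicity_of rs m (w @ [c])
     = multiplicity_of rs m w * (\<Prod>i<l. if suffix (rs ! i) (w @ [c]) then m i else 1)"
proof -
  have "multiplicity_of rs m (w @ [c])
      = (\<Prod>i<l. m i ^ num_occ w (rs ! i) * (if suffix (rs ! i) (w @ [c]) then m i else 1))"
    unfolding multiplicity_of_def
  proof (intro prod.cong refl)
    fix i assume "i \<in> {..<l}"
    then have "rs ! i \<noteq> []" using W_nonempty[of i] by (simp add: nth_append)
    then show "m i ^ num_occ (w @ [c]) (rs ! i)
        = m i ^ num_occ w (rs ! i) * (if suffix (rs ! i) (w @ [c]) then m i else 1)"
      by (simp add: num_occ_snoc)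
  qed
  then show ?thesis by (simp add: multiplicity_of_def prod.distrib)
qed

lemma multiplicity_Cons:
  "multiplicity_of rs m (c # w)
     = multiplicity_of rs m w * (\<Prod>i<l. if prefix (rs ! i) (c # w) then m i else 1)"
proof -
  have "multiplicity_of rs m (c # w)
      = (\<Prod>i<l. m i ^ num_occ w (rs ! i) * (if prefix (rs ! i) (c # w) then m i else 1))"
    unfolding multiplicity_of_def by (intro prod.cong refl) (simp add: num_occ_Cons)
  then show ?thesis by (simp add: multiplicity_of_def prod.distrib)
qed

lemma multiplicity_pos: "0 < multiplicity_of rs m w"
  unfolding multiplicity_of_def by (intro prod_pos) (auto simp: mult_pos)

lemma weight_nonneg: "0 \<le> weight w"
  by (simp add: weight_def)

lemma weight_Nil: "weight [] = 1"
  by (simp add: weight_def free_Nil multiplicity_Nil)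

text \<open>Since the collection is reduced, at most one of its words is a suffix of \<open>w c\<close>.\<close>

lemma weight_snoc:
  "weight (w @ [c]) - weight w
     = (\<Sum>k<N. coef k * (if suffix (W k) (w @ [c]) then end_weight k (w @ [c]) else 0))"
    (is "_ = ?S")
proof (cases "\<exists>k<N. suffix (W k) (w @ [c])")
  case False
  have "\<not> suffix (rs ! i) (w @ [c])" if "i < l" for i
    using False that by (metis nth_append length_append trans_less_add1)
  then have "multiplicity_of rs m (w @ [c]) = multiplicity_of rs m w"
    unfolding multiplicity_snoc by simp
  moreover have "free (w @ [c]) \<longleftrightarrow> free w" using False by (auto simp: free_snoc)
  moreover have "?S = 0" using False by (intro sum.neutral) auto
  ultimately show ?thesis by (simp add: weight_def)
next
  case True
  then obtain j where j: "j < N" "suffix (W j) (w @ [c])" by blast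
  have uniq: "suffix (W k) (w @ [c]) \<longleftrightarrow> k = j" if "k < N" for k
    using suffix_W_unique[OF that j(1) _ j(2)] j(2) by auto
  have "?S = (\<Sum>k<N. if k = j then coef j * end_weight j (w @ [c]) else 0)"
    by (intro sum.cong) (auto simp: uniq)
  then have S: "?S = coef j * end_weight j (w @ [c])" using j(1) by simp
  show ?thesis
  proof (cases "j < l")
    case jl: True
    have "(\<Prod>i<l. if suffix (rs ! i) (w @ [c]) then m i else 1) = (\<Prod>i<l. if i = j then m i else 1)"
    proof (intro prod.cong refl)
      fix i assume "i \<in> {..<l}"
      then show "(if suffix (rs ! i) (w @ [c]) then m i else 1) = (if i = j then m i else 1)"
        using uniq[of i] by (simp add: nth_append)
    qed
    then have "multiplicity_of rs m (w @ [c]) = multiplicity_of rs m w * m j"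
      using jl by (simp add: multiplicity_snoc)
    moreover have "free (w @ [c]) \<longleftrightarrow> free w" using uniq jl by (auto simp: free_snoc)
    ultimately have "weight (w @ [c]) = weight w * real (m j)" by (simp add: weight_def)
    moreover have "coef j * end_weight j (w @ [c]) = (1 - 1 / real (m j)) * weight (w @ [c])"
      using jl by (simp add: coef_def end_weight_def)
    moreover have "real (m j) \<noteq> 0" using mult_pos[OF jl] by simp
    ultimately show ?thesis unfolding S by (simp add: left_diff_distrib)
  next
    case jl: False
    then have "\<not> free (w @ [c])" using j by (auto simp: free_snoc)
    then show ?thesis unfolding S using jl by (simp add: weight_def end_weight_def coef_def)
  qed
qed

text \<open>Sums \<open>weight_snoc\<close> over all extensions by one symbol, of which each word
  has \<open>CARD('a)\<close>; the 1 is the empty word, in which no \<open>W k\<close> ends.\<close>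

lemma weight_gf_eq:
  "gf weight - 1 - of_nat CARD('a) * fps_X * gf weight = (\<Sum>k<N. fps_const (coef k) * end_gf k)"
proof (rule fps_ext)
  fix n
  define t where "t k u = (if suffix (W k) u then end_weight k u else 0)" for k u
  have R: "fps_nth (\<Sum>k<N. fps_const (coef k) * end_gf k) n = (\<Sum>u\<in>words n. \<Sum>k<N. coef k * t k u)"
    by (simp add: end_gf_def t_def flip: gf_sum) (simp add: gf_nth)
  show "fps_nth (gf weight - 1 - of_nat CARD('a) * fps_X * gf weight) n
      = fps_nth (\<Sum>k<N. fps_const (coef k) * end_gf k) n"
  proof (cases n)
    case 0
    have "t k [] = 0" if "k < N" for k using W_nonempty[OF that] by (simp add: t_def)
    then have "(\<Sum>k<N. coef k * t k []) = 0" by (intro sum.neutral) simp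
    then show ?thesis unfolding R using 0 by (simp add: gf_nth weight_Nil mult.assoc)
  next
    case (Suc n')
    have "(\<Sum>u\<in>words n. \<Sum>k<N. coef k * t k u) = (\<Sum>w\<in>words n'. \<Sum>c\<in>UNIV. \<Sum>k<N. coef k * t k (w @ [c]))"
      unfolding Suc by (rule sum_words_snoc)
    also have "\<dots> = (\<Sum>w\<in>words n'. \<Sum>c\<in>UNIV. weight (w @ [c]) - weight w)"
      by (simp only: weight_snoc t_def)
    also have "\<dots> = (\<Sum>w\<in>words n. weight w) - real CARD('a) * (\<Sum>w\<in>words n'. weight w)"
      unfolding Suc sum_words_snoc by (simp add: sum_subtractf sum_distrib_left)
    finally show ?thesis unfolding R using Suc
      by (simp add: gf_nth mult.assoc fps_mult_of_nat_nth)
  qed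
qed

text \<open>A shorter \<open>W k\<close> would lie inside \<open>W b\<close>, so reducedness would
  give \<open>k = b\<close>, against the lengths. This secures the length condition of
  \<open>gf_append_suffix\<close>.\<close>

lemma suffix_take_length:
  assumes "b < N" "k < N" "i < length (W b)" "suffix (W k) (w @ take (Suc i) (W b))"
  shows "Suc i \<le> length (W k)"
proof (rule ccontr)
  assume "\<not> ?thesis"
  moreover from this have "suffix (W k) (take (Suc i) (W b))"
    using suffix_length_suffix[OF assms(4), of "take (Suc i) (W b)"] assms(3) by (simp add: suffixI)
  then have "sublist (W k) (W b)"
    by (meson sublist_order.order.trans sublist_take suffix_imp_sublist)
  with assms(1,2) have "k = b" using sublist_W_eq assms by blast
  ultimately show False using assms(3) by simp
qed

end

section \<open>The correlation matrix\<close>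

text \<open>The expansion of z times the correlation polynomial of \<open>r\<close> and
  \<open>b\<close>, indexed by the length \<open>Suc i\<close> of the overlap instead of its
  position.\<close>

definition overlap_fls :: "'a list \<Rightarrow> 'a list \<Rightarrow> real fls" where
  "overlap_fls r b = (\<Sum>i<length b. if suffix (take (Suc i) b) r then fls_X_inv ^ Suc i else 0)"

text \<open>\<open>overlap_fls\<close> divided by z^|r|: a power series in 1 / z, since no overlap
  is longer than \<open>r\<close>.\<close>

definition overlap_fps :: "'a list \<Rightarrow> 'a list \<Rightarrow> real fps" where
  "overlap_fps r b = (\<Sum>i<length b. if suffix (take (Suc i) b) r then fps_X ^ (length r - Suc i) else 0)"

lemma suffix_take_le: "suffix (take (Suc i) b) r \<Longrightarrow> i < length b \<Longrightarrow> Suc i \<le> length r"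
  using suffix_length_le by fastforce

lemma fls_X_inv_X_power: "k \<le> n \<Longrightarrow> fls_X_inv ^ k * fls_X ^ n = (fls_X ^ (n - k) :: real fls)"
proof -
  assume "k \<le> n"
  then obtain d where n: "n = k + d" using le_Suc_ex by blast
  have "fls_X_inv * fls_X = (1 :: real fls)" by (simp flip: fls_inverse_X)
  then show ?thesis by (simp add: n power_add flip: mult.assoc power_mult_distrib)
qed

lemma overlap_fls_times: "overlap_fls r b * fls_X ^ length r = fps_to_fls (overlap_fps r b)"
proof -
  have "(if suffix (take (Suc i) b) r then fls_X_inv ^ Suc i else 0) * fls_X ^ length r
      = fps_to_fls (if suffix (take (Suc i) b) r then fps_X ^ (length r - Suc i) else 0 :: real fps)"
    if "i < length b" for i
    using suffix_take_le[OF _ that] fls_X_inv_X_power[of "Suc i" "length r"]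
    by (auto simp: fps_to_fls_power simp del: power_Suc)
  then show ?thesis
    by (simp add: overlap_fls_def overlap_fps_def fps_to_fls.hom_sum sum_distrib_right)
qed

context word_system
begin

text \<open>Starting at position \<open>length (W k) - Suc i\<close> leaves \<open>Suc i\<close>
  symbols of \<open>W k\<close> to compare. If \<open>W b\<close> has fewer symbols, a match would
  place it inside \<open>W k\<close>, which reducedness excludes.\<close>

lemma corr_bit_iff:
  assumes "k < N" "b < N" "i < length (W k)"
  shows "corr_bit (W k) (W b) (length (W k) - Suc i)
    \<longleftrightarrow> i < length (W b) \<and> suffix (take (Suc i) (W b)) (W k)"
proof -
  define r where "r = W k"
  define w where "w = W b"
  define d where "d = drop (length r - Suc i) r"
  have i: "i < length r" using assms by (simp add: r_def)
  have len: "length d = Suc i" using i by (simp add: d_def)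
  have bit: "corr_bit r w (length r - Suc i) \<longleftrightarrow> (\<forall>j. j < Suc i \<and> j < length w \<longrightarrow> d ! j = w ! j)"
    using i by (auto simp: corr_bit_def d_def)
  show ?thesis
  proof (cases "i < length w")
    case True
    then have "corr_bit r w (length r - Suc i) \<longleftrightarrow> d = take (Suc i) w"
      using len unfolding bit by (auto simp: list_eq_iff_nth_eq)
    also have "\<dots> \<longleftrightarrow> suffix (take (Suc i) w) r"
    proof
      assume "d = take (Suc i) w"
      then show "suffix (take (Suc i) w) r" unfolding d_def by (metis suffix_drop)
    next
      assume "suffix (take (Suc i) w) r"
      then show "d = take (Suc i) w" using True by (auto simp: suffix_def d_def)
    qed
    finally show ?thesis using True by (simp add: r_def w_def)
  next
    case False
    have "\<not> corr_bit r w (length r - Suc i)"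
    proof
      assume "corr_bit r w (length r - Suc i)"
      then have "take (length w) d = w" using False len unfolding bit by (auto simp: list_eq_iff_nth_eq)
      then have "sublist w r"
        unfolding d_def by (metis sublist_order.order.trans sublist_drop sublist_take)
      then have "b = k" using sublist_W_eq assms by (simp add: r_def w_def)
      then show False using False i by (simp add: r_def w_def)
    qed
    then show ?thesis using False by (simp add: r_def w_def)
  qed
qed

lemma expand_corr_Z:
  assumes "k < N" "b < N"
  shows "expand (Z * corr_Z (W k) (W b)) = overlap_fls (W k) (W b)"
proof -
  let ?r = "W k" and ?w = "W b"
  have "expand (Z * corr_Z ?r ?w)
      = (\<Sum>i<length ?r. if corr_bit ?r ?w i then fls_X_inv ^ Suc (length ?r - Suc i) else 0)"
    by (auto simp: corr_Z_def expand.hom_mult expand.hom_sum expand.hom_power expand_Z sum_distrib_left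
        intro!: sum.cong)
  \<comment> \<open>Reversing the summation passes from the position of an overlap to its
    length.\<close>
  also have "\<dots> = (\<Sum>i<length ?r. if corr_bit ?r ?w (length ?r - Suc i)
      then fls_X_inv ^ Suc (length ?r - Suc (length ?r - Suc i)) else 0)"
    by (rule sum.nat_diff_reindex[symmetric])
  also have "\<dots> = (\<Sum>i<length ?r. if i < length ?w \<and> suffix (take (Suc i) ?w) ?r then fls_X_inv ^ Suc i else 0)"
    by (intro sum.cong) (auto simp: corr_bit_iff[OF assms])
  also have "\<dots> = (\<Sum>i\<in>{i\<in>{..<length ?r}. i < length ?w \<and> suffix (take (Suc i) ?w) ?r}. fls_X_inv ^ Suc i)"
    by (rule sum.inter_filter[symmetric]) simp
  also have "{i\<in>{..<length ?r}. i < length ?w \<and> suffix (take (Suc i) ?w) ?r}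
      = {i\<in>{..<length ?w}. suffix (take (Suc i) ?w) ?r}"
    using suffix_take_le by fastforce
  also have "(\<Sum>i\<in>\<dots>. fls_X_inv ^ Suc i) = overlap_fls ?r ?w"
    unfolding overlap_fls_def by (rule sum.inter_filter) simp
  finally show ?thesis .
qed

text \<open>Only an overlap covering all of \<open>W k\<close> contributes; then \<open>W k\<close>
  is a prefix of \<open>W b\<close>, and reducedness gives equality.\<close>

lemma overlap_fps_nth_0:
  assumes "k < N" "b < N"
  shows "fps_nth (overlap_fps (W k) (W b)) 0 = (if k = b then 1 else 0)"
proof -
  let ?r = "W k" and ?w = "W b"
  have "fps_nth (if suffix (take (Suc i) ?w) ?r then fps_X ^ (length ?r - Suc i) else 0) 0
      = (if k = b \<and> i = length ?w - 1 then 1 else 0 :: real)" if i: "i < length ?w" for i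
  proof (cases "suffix (take (Suc i) ?w) ?r")
    case True
    note le = suffix_take_le[OF True i]
    show ?thesis
    proof (cases "Suc i = length ?r")
      case eq: True
      obtain zs where zs: "?r = zs @ take (Suc i) ?w" using True by (auto simp: suffix_def)
      have "length zs = 0" using arg_cong[OF zs, of length] eq i by simp
      then have "take (Suc i) ?w = ?r" using zs by simp
      then have "sublist ?r ?w" by (metis sublist_take)
      then have "k = b" using sublist_W_eq assms by blast
      then show ?thesis using True eq by auto
    next
      case False
      then have "length ?r - Suc i \<noteq> 0" using le by simp
      then show ?thesis using True False i by auto
    qed
  next
    case False
    then have "\<not> (k = b \<and> i = length ?w - 1)" using i by auto
    then show ?thesis using False by auto
  qed
  then have "fps_nth (overlap_fps ?r ?w) 0
      = (\<Sum>i<length ?w. if k = b \<and> i = length ?w - 1 then 1 else 0)"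
    unfolding overlap_fps_def fps_sum_nth by (intro sum.cong) auto
  also have "\<dots> = (\<Sum>i<length ?w. if i = length ?w - 1 then (if k = b then 1 else 0) else 0)"
    by (intro sum.cong) auto
  also have "\<dots> = (if k = b then 1 else 0)"
    using W_nonempty[OF assms(2)] by simp
  finally show ?thesis .
qed

text \<open>Telescopes \<open>weight_snoc\<close> over the prefixes of \<open>W b\<close>. At length
  i + 1 exactly those \<open>W k\<close> contribute that end in this prefix, each with z^(i+1) times
  \<open>end_gf k\<close>.\<close>

lemma gf_weight_append:
  assumes b: "b < N"
  shows "fps_to_fls (gf (\<lambda>w. weight (w @ W b))) - fps_to_fls (gf weight)
    = (\<Sum>k<N. fls_const (coef k) * overlap_fls (W k) (W b) * fps_to_fls (end_gf k))"
proof -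
  define F where "F i = gf (\<lambda>w. weight (w @ take i (W b)))" for i
  define H where "H i k = gf (\<lambda>w. if suffix (W k) (w @ take i (W b))
    then end_weight k (w @ take i (W b)) else 0)" for i k
  have step: "F (Suc i) - F i = (\<Sum>k<N. fps_const (coef k) * H (Suc i) k)" if "i < length (W b)" for i
  proof -
    have eq: "take (Suc i) (W b) = take i (W b) @ [W b ! i]"
      using that by (rule take_Suc_conv_app_nth)
    have "weight (w @ take (Suc i) (W b)) - weight (w @ take i (W b))
      = (\<Sum>k<N. coef k * (if suffix (W k) (w @ take (Suc i) (W b))
           then end_weight k (w @ take (Suc i) (W b)) else 0))" for w
      using weight_snoc[of "w @ take i (W b)" "W b ! i"] unfolding eq by (simp only: append_assoc)
    then show ?thesis by (simp add: F_def H_def flip: gf_diff gf_sum)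
  qed
  have H: "fps_to_fls (H (Suc i) k)
      = (if suffix (take (Suc i) (W b)) (W k) then fls_X_inv ^ Suc i else 0) * fps_to_fls (end_gf k)"
    if i: "i < length (W b)" and k: "k < N" for i k
  proof -
    have "fps_X ^ Suc i * H (Suc i) k = (if suffix (take (Suc i) (W b)) (W k) then end_gf k else 0)"
    proof (cases "Suc i \<le> length (W k)")
      case True
      have len: "length (take (Suc i) (W b)) = Suc i" using i by simp
      show ?thesis
        using gf_append_suffix[of "take (Suc i) (W b)" "W k" "end_weight k"] True
        unfolding len H_def end_gf_def by blast
    next
      case False
      then have "\<not> suffix (W k) (w @ take (Suc i) (W b))" for w
        using suffix_take_length[OF b k i] by blast
      then have "H (Suc i) k = 0" unfolding H_def by (intro fps_ext) (simp add: gf_nth)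
      moreover have "\<not> suffix (take (Suc i) (W b)) (W k)" using False i suffix_take_le by blast
      ultimately show ?thesis by simp
    qed
    then have "fls_X ^ Suc i * fps_to_fls (H (Suc i) k)
        = (if suffix (take (Suc i) (W b)) (W k) then fps_to_fls (end_gf k) else 0)"
      by (metis fls_times_fps_to_fls fps_X_to_fls fps_to_fls_power fps_zero_to_fls)
    then have "fls_X_inv ^ Suc i * fls_X ^ Suc i * fps_to_fls (H (Suc i) k)
        = (if suffix (take (Suc i) (W b)) (W k) then fls_X_inv ^ Suc i else 0) * fps_to_fls (end_gf k)"
      by (simp add: mult.assoc del: power_Suc)
    then show ?thesis by (simp add: fls_X_inv_X_power del: power_Suc)
  qed
  have "fps_to_fls (F (length (W b))) - fps_to_fls (F 0)
      = (\<Sum>i<length (W b). fps_to_fls (F (Suc i)) - fps_to_fls (F i))"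
    by (rule sum_lessThan_telescope[symmetric])
  also have "\<dots> = (\<Sum>i<length (W b). \<Sum>k<N. fls_const (coef k)
      * (if suffix (take (Suc i) (W b)) (W k) then fls_X_inv ^ Suc i else 0) * fps_to_fls (end_gf k))"
  proof (intro sum.cong refl)
    fix i assume "i \<in> {..<length (W b)}"
    then have i: "i < length (W b)" by simp
    have "fps_to_fls (F (Suc i)) - fps_to_fls (F i) = fps_to_fls (\<Sum>k<N. fps_const (coef k) * H (Suc i) k)"
      using step[OF i] by (metis fps_to_fls_minus)
    also have "\<dots> = (\<Sum>k<N. fls_const (coef k) * fps_to_fls (H (Suc i) k))"
      by (simp add: fps_to_fls.hom_sum fls_times_fps_to_fls)
    finally show "fps_to_fls (F (Suc i)) - fps_to_fls (F i) = (\<Sum>k<N. fls_const (coef k)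
      * (if suffix (take (Suc i) (W b)) (W k) then fls_X_inv ^ Suc i else 0) * fps_to_fls (end_gf k))"
      using H[OF i] by (simp add: mult.assoc del: power_Suc)
  qed
  also have "\<dots> = (\<Sum>k<N. fls_const (coef k) * overlap_fls (W k) (W b) * fps_to_fls (end_gf k))"
    by (subst sum.swap) (simp add: overlap_fls_def sum_distrib_left sum_distrib_right del: power_Suc)
  finally show ?thesis by (simp add: F_def)
qed

text \<open>A second evaluation of the series from \<open>gf_weight_append\<close>; equating the two
  gives row \<open>b\<close> of the linear system.\<close>

lemma gf_weight_append_self:
  assumes b: "b < N"
  shows "fps_to_fls (gf (\<lambda>w. weight (w @ W b)))
    = (if b < l then fls_X_inv ^ length (W b) * fps_to_fls (end_gf b) else 0)"
proof (cases "b < l")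
  case True
  have "fps_X ^ length (W b) * gf (\<lambda>w. weight (w @ W b)) = end_gf b"
    using gf_append_suffix[of "W b" "W b" "end_weight b"] True
    by (simp add: end_gf_def end_weight_def suffixI)
  then have "fls_X ^ length (W b) * fps_to_fls (gf (\<lambda>w. weight (w @ W b))) = fps_to_fls (end_gf b)"
    by (metis fls_times_fps_to_fls fps_X_to_fls fps_to_fls_power)
  then have "fls_X_inv ^ length (W b) * fls_X ^ length (W b) * fps_to_fls (gf (\<lambda>w. weight (w @ W b)))
      = fls_X_inv ^ length (W b) * fps_to_fls (end_gf b)"
    by (simp add: mult.assoc)
  then show ?thesis using True by (simp add: fls_X_inv_X_power)
next
  case False
  then have "W b \<in> set fs" using b by (simp add: nth_append)
  then have "\<not> free (w @ W b)" for w using suffixI suffix_imp_sublist by (auto simp: free_def)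
  then have "gf (\<lambda>w. weight (w @ W b)) = 0" by (intro fps_ext) (simp add: gf_nth weight_def)
  then show ?thesis using False by simp
qed

section \<open>The matrix P, its linear system and the elimination\<close>

definition dcoef :: "nat \<Rightarrow> ratfun" where
  "dcoef k = Z * (if k < l then defect m k else -1)"

lemma expand_dcoef: "expand (dcoef k) = fls_X_inv * fls_const (coef k)"
proof -
  have "fls_const (1 / real (m k)) = 1 / of_nat (m k)"
    by (metis fls_const_1 fls_const_divide_const fls_of_nat)
  then show ?thesis
    by (simp add: dcoef_def coef_def defect_def expand_Z hom_distribs fls_const.hom_minus
        fls_const.hom_uminus)
qed

lemma dcoef_nonzero: "k < N \<Longrightarrow> dcoef k \<noteq> 0"
proof -
  have "coef k \<noteq> 0" using mult_ge_2[of k] by (auto simp: coef_def)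
  then have "expand (dcoef k) \<noteq> 0" by (simp add: expand_dcoef)
  then show ?thesis by auto
qed

lemma P_mat_carrier: "P_mat fs rs m \<in> carrier_mat N N"
  by (simp add: P_mat_def Let_def)

text \<open>With \<open>dcoef\<close>, the diagonal of D, the four blocks of P take a common
  form.\<close>

lemma P_mat_entry:
  assumes "i < N" "j < N"
  shows "P_mat fs rs m $$ (i, j)
    = dcoef j * corr_Z (W j) (W i) - (if i = j \<and> j < l then Z ^ length (W j) else 0)"
  using assms by (auto simp: P_mat_def Let_def dcoef_def nth_append)

lemma expand_P_mat_entry:
  assumes "i < N" "j < N"
  shows "expand (P_mat fs rs m $$ (i, j)) = fls_const (coef j) * overlap_fls (W j) (W i)
    - (if i = j \<and> j < l then fls_X_inv ^ length (W j) else 0)"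
proof -
  have "expand (dcoef j * corr_Z (W j) (W i)) = fls_const (coef j) * expand (Z * corr_Z (W j) (W i))"
    by (simp add: expand.hom_mult expand_dcoef expand_Z)
  then show ?thesis
    by (simp add: P_mat_entry[OF assms] expand_corr_Z[OF assms(2,1)] expand.hom_minus expand.hom_power expand_Z)
qed

lemma P_mat_system:
  assumes i: "i < N"
  shows "(\<Sum>j<N. expand (P_mat fs rs m $$ (i, j)) * fps_to_fls (end_gf j)) = - fps_to_fls (gf weight)"
proof -
  have "(\<Sum>j<N. expand (P_mat fs rs m $$ (i, j)) * fps_to_fls (end_gf j))
      = (\<Sum>j<N. fls_const (coef j) * overlap_fls (W j) (W i) * fps_to_fls (end_gf j))
        - (\<Sum>j<N. if j = i then (if i < l then fls_X_inv ^ length (W i) * fps_to_fls (end_gf i) else 0) else 0)"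
    unfolding sum_subtractf[symmetric]
    by (intro sum.cong refl) (simp add: expand_P_mat_entry[OF i] algebra_simps)
  also have "\<dots> = - fps_to_fls (gf weight)"
    using i unfolding gf_weight_append[OF i, symmetric] gf_weight_append_self[OF i]
    by (simp del: length_append)
  finally show ?thesis .
qed

text \<open>Column \<open>j\<close> is scaled by X to the length of \<open>W j\<close>. Only
  complete overlaps reach the constant term, leaving -1 / m_j on the diagonal for repeated words and
  -1 for forbidden ones.\<close>

lemma det_P_mat_nonzero: "det (P_mat fs rs m) \<noteq> 0"
proof (rule det_expand_nonzero[OF P_mat_carrier])
  let ?N = "\<lambda>i j. fps_const (coef j) * overlap_fps (W j) (W i) - (if i = j \<and> j < l then 1 else 0)"
  fix i j assume ij: "i < N" "j < N"
  show "expand (P_mat fs rs m $$ (i, j)) * fls_X ^ length (W j) = fps_to_fls (?N i j)"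
    by (auto simp: expand_P_mat_entry[OF ij] left_diff_distrib mult.assoc overlap_fls_times
        fls_times_fps_to_fls fls_X_inv_X_power)
  show "fps_nth (?N i j) 0 = (if i = j then coef i - (if i < l then 1 else 0) else 0)"
    using ij by (auto simp: overlap_fps_nth_0)
next
  show "coef i - (if i < l then 1 else 0) \<noteq> 0" if "i < N" for i
    using mult_pos[of i] by (auto simp: coef_def)
qed

text \<open>The row sums are a parameter, so that one definition covers both functions of the
  theorem.\<close>

definition char_fun :: "(nat \<Rightarrow> ratfun) \<Rightarrow> ratfun" where
  "char_fun R = Z - of_nat CARD('a) + Z * (\<Sum>i<l. defect m i * R i) - Z * (\<Sum>j<length fs. R (l + j))"

lemma char_fun_eq: "char_fun R = Z - of_nat CARD('a) + (\<Sum>k<N. dcoef k * R k)"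
proof -
  have "(\<Sum>k<N. dcoef k * R k) = (\<Sum>k<l. dcoef k * R k) + (\<Sum>j<length fs. dcoef (l + j) * R (l + j))"
    using sum.shift_bounds_nat_ivl[of "\<lambda>k. dcoef k * R k" 0 l "length fs"]
      sum.atLeastLessThan_concat[of 0 l "l + length fs" "\<lambda>k. dcoef k * R k"]
    by (simp add: lessThan_atLeast0 add.commute)
  then show ?thesis
    by (simp add: char_fun_def dcoef_def sum_distrib_left sum_negf mult.assoc)
qed

lemma expand_char_fun:
  "expand (char_fun (R_sum fs rs m)) * fps_to_fls (gf weight) = fls_X_inv"
proof -
  define G where "G = fps_to_fls (gf weight)"
  define u where "u k = fps_to_fls (end_gf k)" for k
  have u: "u k = - expand (R_sum fs rs m k) * G" if "k < N" for k
    unfolding u_def R_sum_def G_def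
    by (rule solve_by_row_sums[OF P_mat_carrier det_P_mat_nonzero P_mat_system that])
  have "G - 1 - of_nat CARD('a) * fls_X * G = (\<Sum>k<N. fls_const (coef k) * u k)"
    using arg_cong[OF weight_gf_eq, of fps_to_fls]
    by (simp add: G_def u_def fps_to_fls.hom_sum fls_times_fps_to_fls)
  \<comment> \<open>Multiplication by z turns \<open>coef k\<close> into the diagonal entry
    \<open>dcoef k\<close>.\<close>
  then have "fls_X_inv * (G - 1 - of_nat CARD('a) * fls_X * G) = (\<Sum>k<N. expand (dcoef k) * u k)"
    by (simp add: sum_distrib_left expand_dcoef mult.assoc)
  also have "\<dots> = - (\<Sum>k<N. expand (dcoef k * R_sum fs rs m k)) * G"
    by (simp add: u expand.hom_mult sum_distrib_right sum_negf mult.assoc)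
  also have "fls_X_inv * (G - 1 - of_nat CARD('a) * fls_X * G)
      = fls_X_inv * G - fls_X_inv - of_nat CARD('a) * (fls_X_inv * fls_X) * G"
    by (simp add: algebra_simps)
  also have "fls_X_inv * fls_X = (1 :: real fls)"
    using fls_X_inv_X_power[of 1 1] by simp
  finally show ?thesis
    by (simp add: char_fun_eq hom_distribs expand_Z G_def[symmetric] algebra_simps)
qed

lemma char_fun_S_sum: "char_fun (S_sum fs rs m) = char_fun (R_sum fs rs m)"
proof -
  note inv = matinv_inverse[OF P_mat_carrier det_P_mat_nonzero]
  define V where "V = matinv (P_mat fs rs m)"
  have V: "V \<in> carrier_mat N N" using inv(1) by (simp add: V_def)
  have "D_mat fs rs m = mat N N (\<lambda>(i, j). if i = j then dcoef i else 0)"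
    by (rule eq_matI) (auto simp: D_mat_def Let_def dcoef_def)
  then have Q: "matinv (Q_mat fs rs m) = mat N N (\<lambda>(i, j). V $$ (j, i) * dcoef j / dcoef i)"
    unfolding Q_mat_def V_def
    using matinv_diag_conjugate_transpose[OF P_mat_carrier det_P_mat_nonzero dcoef_nonzero] by simp
  \<comment> \<open>The factor \<open>dcoef k\<close> cancels the denominator in row
    \<open>k\<close> of the inverse of Q.\<close>
  have "(\<Sum>k<N. dcoef k * S_sum fs rs m k) = (\<Sum>k<N. \<Sum>j<N. V $$ (j, k) * dcoef j)"
    by (intro sum.cong refl) (auto simp: S_sum_def row_sum_def Q sum_distrib_left dcoef_nonzero)
  also have "\<dots> = (\<Sum>j<N. dcoef j * R_sum fs rs m j)"
    using V by (subst sum.swap) (simp add: R_sum_def row_sum_def V_def[symmetric] sum_distrib_left mult.commute)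
  finally show ?thesis by (simp add: char_fun_eq)
qed

end

section \<open>The transfer matrix\<close>

lemma map_upt_sublist:
  assumes "sublist a (map x [k..<k + n])"
  obtains j where "k \<le> j" "a = map x [j..<j + length a]"
proof -
  obtain u v where uv: "map x [k..<k + n] = u @ a @ v" using assms by (auto simp: sublist_def)
  have len: "n = length u + length a + length v" using arg_cong[OF uv, of length] by simp
  have "a = map x [k + length u..<k + length u + length a]"
  proof (rule nth_equalityI)
    fix i assume i: "i < length a"
    have "(u @ a @ v) ! (length u + i) = x (k + length u + i)"
      unfolding uv[symmetric] using i len by (simp add: add_ac)
    then show "a ! i = map x [k + length u..<k + length u + length a] ! i"
      using i by (simp add: nth_append)
  qed simp
  then show ?thesis by (intro that[of "k + length u"]) auto
qed

lemma map_upt_Suc: "map x [k..<k + Suc n] = x k # map x [Suc k..<Suc k + n]"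
  by (subst upt_conv_Cons) auto

text \<open>Here \<open>d\<close> stands for \<open>p - 1\<close>, and \<open>vs\<close> enumerates the vertices of the transfer matrix.\<close>

locale transfer_system = word_system fs rs m
  for fs rs :: "'a::finite list list" and m +
  fixes d :: nat and vs :: "'a list list"
  assumes d_pos: "0 < d"
    and length_le: "w \<in> set (rs @ fs) \<Longrightarrow> length w \<le> Suc d"
    and distinct_vs: "distinct vs"
    and set_vs: "set vs = {w \<in> words d. free w}"
begin

text \<open>\<open>adjacency_entry\<close> with \<open>free\<close> in place of allowed, which makes
  it a local condition on the edge.\<close>

definition step :: "'a list \<Rightarrow> 'a list \<Rightarrow> real" where
  "step X Y = (if tl X = butlast Y \<and> free (X @ [last Y]) then k_weight rs m (X @ [last Y]) else 0)"

definition B :: "real mat" where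
  "B = mat (length vs) (length vs) (\<lambda>(i, j). step (vs ! i) (vs ! j))"

definition path_gf :: "'a list \<Rightarrow> real fps" where
  "path_gf v = gf (\<lambda>w. weight (v @ w))"

lemma B_carrier: "B \<in> carrier_mat (length vs) (length vs)"
  by (simp add: B_def)

lemma prefix_W_iff:
  assumes "length v = d" "w \<in> set (rs @ fs)"
  shows "prefix w (v @ c # u) \<longleftrightarrow> prefix w (v @ [c])"
proof -
  have "prefix (v @ [c]) (v @ c # u)" by (simp add: prefix_def)
  moreover have "length w \<le> length (v @ [c])" using assms length_le by simp
  ultimately show ?thesis using prefix_length_prefix prefix_order.trans by blast
qed

text \<open>By \<open>multiplicity_Cons\<close> the quotient retains only repeated words occurring
  at the very beginning.\<close>

lemma k_weight_eq:
  assumes "v \<noteq> []"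
  shows "k_weight rs m (v @ [c]) = real (\<Prod>i<l. if prefix (rs ! i) (v @ [c]) then m i else 1)"
proof -
  obtain x v' where "v = x # v'" using assms by (cases v) auto
  moreover have "multiplicity_of rs m (v' @ [c]) \<noteq> 0" using multiplicity_pos by (metis less_irrefl)
  ultimately show ?thesis by (simp add: k_weight_def multiplicity_Cons)
qed

lemma k_weight_ge_1:
  assumes "v \<noteq> []"
  shows "1 \<le> k_weight rs m (v @ [c])"
proof -
  have "1 \<le> (\<Prod>i<l. if prefix (rs ! i) (v @ [c]) then m i else 1)"
    by (intro prod_ge_1) (use mult_pos in \<open>auto simp: Suc_le_eq\<close>)
  then show ?thesis unfolding k_weight_eq[OF assms] by linarith
qed

lemma step_nonneg: "0 \<le> step X Y"
  by (auto simp: step_def k_weight_def)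

text \<open>A forbidden or repeated word that is a prefix of a path starting in \<open>v\<close> is already visible in
  the first \<open>d + 1\<close> symbols.\<close>

lemma weight_append_Cons:
  assumes v: "length v = d"
  shows "weight (v @ c # u)
    = (if free (v @ [c]) then k_weight rs m (v @ [c]) * weight ((tl v @ [c]) @ u) else 0)"
proof -
  obtain x v' where v': "v = x # v'" using v d_pos by (cases v) auto
  have v_ne: "v \<noteq> []" using v' by simp
  show ?thesis
  proof (cases "free (v @ [c])")
    case False
    have "sublist (v @ [c]) (v @ c # u)"
      by (intro prefix_imp_sublist) (simp add: prefix_def)
    then have "\<not> free (v @ c # u)" using False free_sublist by blast
    then show ?thesis using False by (simp add: weight_def)
  next
    case True
    have "\<not> prefix a (v @ c # u)" if "a \<in> set fs" for a
      using prefix_W_iff[OF v] True that prefix_imp_sublist[of a "v @ [c]"] by (auto simp: free_def)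
    then have free: "free (v @ c # u) \<longleftrightarrow> free ((tl v @ [c]) @ u)"
      by (auto simp: free_def v' sublist_Cons_right)
    have "(\<Prod>i<l. if prefix (rs ! i) (v @ c # u) then m i else 1)
        = (\<Prod>i<l. if prefix (rs ! i) (v @ [c]) then m i else 1)"
      using prefix_W_iff[OF v] by (intro prod.cong) auto
    then have "real (multiplicity_of rs m (v @ c # u))
        = k_weight rs m (v @ [c]) * real (multiplicity_of rs m ((tl v @ [c]) @ u))"
      unfolding k_weight_eq[OF v_ne] using multiplicity_Cons[of x "v' @ c # u"] by (simp add: v')
    then show ?thesis using True free by (simp add: weight_def)
  qed
qed

text \<open>Successors of \<open>v\<close> have the form \<open>tl v @ [c]\<close>, so summing over
  symbols visits each vertex with a non-zero entry exactly once.\<close>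

lemma sum_step:
  assumes v: "v \<in> set vs"
  shows "(\<Sum>Y\<in>set vs. step v Y * g Y)
    = (\<Sum>c\<in>UNIV. if free (v @ [c]) then k_weight rs m (v @ [c]) * g (tl v @ [c]) else 0)"
proof -
  have len: "length v = d" "v \<noteq> []" using v d_pos by (auto simp: set_vs words_def)
  let ?S = "{c \<in> UNIV. free (v @ [c])}"
  let ?f = "\<lambda>c. tl v @ [c]"
  have "(\<Sum>c\<in>UNIV. if free (v @ [c]) then k_weight rs m (v @ [c]) * g (tl v @ [c]) else 0)
      = (\<Sum>c\<in>?S. k_weight rs m (v @ [c]) * g (tl v @ [c]))"
    by (rule sum.inter_filter[symmetric]) simp
  also have "\<dots> = (\<Sum>c\<in>?S. step v (?f c) * g (?f c))"
    by (intro sum.cong) (auto simp: step_def)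
  also have "\<dots> = (\<Sum>Y\<in>?f ` ?S. step v Y * g Y)"
    by (subst sum.reindex) (auto simp: inj_on_def)
  also have "\<dots> = (\<Sum>Y\<in>set vs. step v Y * g Y)"
  proof (rule sum.mono_neutral_left)
    show "?f ` ?S \<subseteq> set vs"
    proof
      fix Y assume "Y \<in> ?f ` ?S"
      then obtain c where c: "Y = tl v @ [c]" "free (v @ [c])" by auto
      have "sublist (tl v @ [c]) (v @ [c])"
        using len(2) by (metis suffix_imp_sublist suffix_tl tl_append2)
      then show "Y \<in> set vs" using c len d_pos free_sublist by (auto simp: set_vs words_def)
    qed
    show "\<forall>Y\<in>set vs - ?f ` ?S. step v Y * g Y = 0"
    proof
      fix Y assume Y: "Y \<in> set vs - ?f ` ?S"
      then have "Y \<noteq> []" using d_pos by (auto simp: set_vs words_def)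
      then have "\<not> (tl v = butlast Y \<and> free (v @ [last Y]))"
        using Y append_butlast_last_id[of Y] by (auto simp: image_iff)
      then show "step v Y * g Y = 0" by (auto simp: step_def)
    qed
  qed simp
  finally show ?thesis by simp
qed

text \<open>Splits off the first symbol after \<open>v\<close>. In matrix form this is (I - X B) x =
  w, with x the vector of path series and w that of the vertex weights.\<close>

lemma path_gf_rec:
  assumes v: "v \<in> set vs"
  shows "path_gf v = fps_const (weight v) + fps_X * (\<Sum>Y\<in>set vs. fps_const (step v Y) * path_gf Y)"
proof (rule fps_ext)
  fix n
  have len: "length v = d" using v by (simp add: set_vs words_def)
  show "fps_nth (path_gf v) n
      = fps_nth (fps_const (weight v) + fps_X * (\<Sum>Y\<in>set vs. fps_const (step v Y) * path_gf Y)) n"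
  proof (cases n)
    case 0
    then show ?thesis by (simp add: path_gf_def gf_nth)
  next
    case (Suc n')
    have "(\<Sum>Y\<in>set vs. step v Y * (\<Sum>w\<in>words n'. weight (Y @ w)))
        = (\<Sum>c\<in>UNIV. \<Sum>w\<in>words n'. weight (v @ c # w))"
      unfolding sum_step[OF v] by (intro sum.cong refl) (simp add: weight_append_Cons[OF len] sum_distrib_left)
    then show ?thesis
      by (simp add: Suc path_gf_def gf_nth fps_sum_nth sum_words_Cons)
  qed
qed

text \<open>Words of length at least \<open>d\<close> are cut after \<open>d\<close> symbols; only
  finitely many shorter ones remain.\<close>

lemma weight_gf_decomp:
  "gf weight = (\<Sum>n<d. fps_const (fps_nth (gf weight) n) * fps_X ^ n)
     + fps_X ^ d * (\<Sum>v\<in>set vs. path_gf v)"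
proof (rule fps_ext)
  fix n
  have cut: "fps_nth (\<Sum>i<d. fps_const (fps_nth (gf weight) i) * fps_X ^ i) n
      = (if n < d then fps_nth (gf weight) n else 0)"
  proof -
    have "fps_nth (\<Sum>i<d. fps_const (fps_nth (gf weight) i) * fps_X ^ i) n
        = (\<Sum>i<d. if i = n then fps_nth (gf weight) i else 0)"
      unfolding fps_sum_nth by (intro sum.cong) auto
    then show ?thesis by simp
  qed
  show "fps_nth (gf weight) n = fps_nth ((\<Sum>n<d. fps_const (fps_nth (gf weight) n) * fps_X ^ n)
     + fps_X ^ d * (\<Sum>v\<in>set vs. path_gf v)) n"
  proof (cases "n < d")
    case True
    then show ?thesis by (simp add: cut fps_X_power_mult_nth)
  next
    case False
    define k where "k = n - d"
    have n: "n = d + k" using False by (simp add: k_def)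
    have "(\<Sum>u\<in>words n. weight u) = (\<Sum>(v, w)\<in>words d \<times> words k. weight (v @ w))"
      by (rule sum.reindex_bij_witness[of _ "\<lambda>(v, w). v @ w" "\<lambda>u. (take d u, drop d u)"])
        (auto simp: words_def n)
    also have "\<dots> = (\<Sum>v\<in>words d. \<Sum>w\<in>words k. weight (v @ w))"
      by (simp add: sum.cartesian_product)
    also have "\<dots> = (\<Sum>v\<in>set vs. \<Sum>w\<in>words k. weight (v @ w))"
    proof (rule sum.mono_neutral_right)
      show "\<forall>v\<in>words d - set vs. (\<Sum>w\<in>words k. weight (v @ w)) = 0"
      proof
        fix v assume "v \<in> words d - set vs"
        then have "\<not> free v" by (simp add: set_vs)
        then have "\<not> free (v @ w)" for w using free_sublist by blast
        then show "(\<Sum>w\<in>words k. weight (v @ w)) = 0" by (simp add: weight_def)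
      qed
    qed (auto simp: set_vs)
    finally show ?thesis using False
      by (simp add: cut fps_X_power_mult_nth fps_sum_nth path_gf_def gf_nth k_def)
  qed
qed

text \<open>The recursion for the path series reads (z I - B) x = z w; multiplying by the adjugate
  from the left solves it without division.\<close>

lemma resolvent:
  fixes i
  defines "M \<equiv> adj_mat (char_poly_matrix B)"
  assumes i: "i < length vs"
  shows "poly_to_fls (char_poly B) * fps_to_fls (path_gf (vs ! i))
    = fls_X_inv * poly_to_fls (\<Sum>k<length vs. M $$ (i, k) * [:weight (vs ! k):])"
proof -
  let ?n = "length vs"
  define x where "x k = fps_to_fls (path_gf (vs ! k))" for k
  have x: "fls_X_inv * x k - (\<Sum>j<?n. fls_const (B $$ (k, j)) * x j) = fls_X_inv * fls_const (weight (vs ! k))"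
    if "k < ?n" for k
  proof -
    have "x k = fls_const (weight (vs ! k)) + fls_X * (\<Sum>Y\<in>set vs. fls_const (step (vs ! k) Y) * fps_to_fls (path_gf Y))"
      using arg_cong[OF path_gf_rec[of "vs ! k"], of fps_to_fls] that
      by (simp add: x_def fps_to_fls.hom_sum fls_times_fps_to_fls)
    also have "(\<Sum>Y\<in>set vs. fls_const (step (vs ! k) Y) * fps_to_fls (path_gf Y))
        = (\<Sum>j<?n. fls_const (B $$ (k, j)) * x j)"
      using that by (simp add: B_def x_def flip: sum_nth_distinct[OF distinct_vs])
    finally have "fls_X_inv * x k = fls_X_inv * fls_const (weight (vs ! k))
        + (fls_X_inv * fls_X) * (\<Sum>j<?n. fls_const (B $$ (k, j)) * x j)"
      by (simp only: distrib_left mult.assoc)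
    moreover have "fls_X_inv * fls_X = (1 :: real fls)" using fls_X_inv_X_power[of 1 1] by simp
    ultimately show ?thesis by simp
  qed
  let ?M = "\<lambda>i k. poly_to_fls (M $$ (i, k))"
  have adj: "fls_X_inv * ?M i j - (\<Sum>k<?n. ?M i k * fls_const (B $$ (k, j)))
      = (if j = i then poly_to_fls (char_poly B) else 0)" if "j < ?n" for j
    using arg_cong[OF adj_char_poly_matrix(2)[OF B_carrier i that], of poly_to_fls]
    by (simp add: M_def poly_to_fls.hom_minus poly_to_fls.hom_mult poly_to_fls.hom_sum
        poly_to_fls_pCons if_distrib[of poly_to_fls] eq_commute[of i j] del: mult_pCons_left mult_pCons_right)
  have "poly_to_fls (char_poly B) * x i = (\<Sum>j<?n. if j = i then poly_to_fls (char_poly B) * x j else 0)"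
    using i by simp
  also have "\<dots> = (\<Sum>j<?n. (fls_X_inv * ?M i j - (\<Sum>k<?n. ?M i k * fls_const (B $$ (k, j)))) * x j)"
    by (intro sum.cong) (auto simp: adj)
  also have "\<dots> = (\<Sum>k<?n. ?M i k * (fls_X_inv * x k)) - (\<Sum>j<?n. \<Sum>k<?n. ?M i k * (fls_const (B $$ (k, j)) * x j))"
    by (simp add: algebra_simps sum_subtractf sum_distrib_left sum_distrib_right)
  also have "\<dots> = (\<Sum>k<?n. ?M i k * (fls_X_inv * x k - (\<Sum>j<?n. fls_const (B $$ (k, j)) * x j)))"
    by (subst sum.swap) (simp add: right_diff_distrib sum_subtractf sum_distrib_left)
  also have "\<dots> = (\<Sum>k<?n. ?M i k * (fls_X_inv * fls_const (weight (vs ! k))))"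
    by (intro sum.cong refl) (simp add: x)
  also have "\<dots> = fls_X_inv * poly_to_fls (\<Sum>k<?n. M $$ (i, k) * [:weight (vs ! k):])"
    by (simp add: poly_to_fls.hom_sum poly_to_fls.hom_mult poly_to_fls_const sum_distrib_left mult_ac
        del: mult_pCons_left mult_pCons_right)
  finally show ?thesis by (simp add: x_def)
qed

section \<open>The generating function as a quotient of polynomials\<close>

definition adj_sum :: "real poly" where
  "adj_sum = (\<Sum>i<length vs. \<Sum>k<length vs.
     adj_mat (char_poly_matrix B) $$ (i, k) * [:weight (vs ! k):])"

definition low_part :: "real poly" where
  "low_part = (\<Sum>n<d. [:fps_nth (gf weight) n:] * [:0, 1:] ^ (d - n))"

text \<open>Chosen so that z^d G = numer / \<chi>: \<open>low_part\<close> is z^d times the part of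
  G from words shorter than \<open>d\<close>, the other summand comes from
  \<open>resolvent\<close>.\<close>

definition numer :: "real poly" where
  "numer = char_poly B * low_part + [:0, 1:] * adj_sum"

lemma expand_numer:
  "poly_to_fls numer = fls_X_inv ^ d * poly_to_fls (char_poly B) * fps_to_fls (gf weight)"
proof -
  have X: "poly_to_fls [:0, 1:] = fls_X_inv" by (simp add: poly_to_fls_pCons)
  have low: "fls_X_inv ^ d * (fls_const c * fls_X ^ n) = fls_const c * fls_X_inv ^ (d - n)"
    if "n < d" for c :: real and n
  proof -
    have "fls_X_inv ^ d = fls_X_inv ^ (d - n) * (fls_X_inv ^ n :: real fls)"
      using that by (simp flip: power_add)
    moreover have "fls_X_inv ^ n * fls_X ^ n = (1 :: real fls)" by (simp add: fls_X_inv_X_power)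
    ultimately show ?thesis by (simp add: mult.assoc mult.left_commute[of _ "fls_const c"])
  qed
  have G: "fps_to_fls (gf weight)
      = (\<Sum>n<d. fls_const (fps_nth (gf weight) n) * fls_X ^ n)
        + fls_X ^ d * (\<Sum>i<length vs. fps_to_fls (path_gf (vs ! i)))"
    using arg_cong[OF weight_gf_decomp, of fps_to_fls]
    by (simp add: fps_to_fls.hom_sum fls_times_fps_to_fls fps_to_fls_power sum_nth_distinct[OF distinct_vs, of "\<lambda>v. fps_to_fls (path_gf v)"])
  have "fls_X_inv ^ d * fps_to_fls (gf weight)
      = (\<Sum>n<d. fls_X_inv ^ d * (fls_const (fps_nth (gf weight) n) * fls_X ^ n))
        + fls_X_inv ^ d * fls_X ^ d * (\<Sum>i<length vs. fps_to_fls (path_gf (vs ! i)))"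
    by (subst G) (simp only: distrib_left sum_distrib_left mult.assoc)
  also have "(\<Sum>n<d. fls_X_inv ^ d * (fls_const (fps_nth (gf weight) n) * fls_X ^ n)) = poly_to_fls low_part"
    by (simp add: low low_part_def poly_to_fls.hom_sum poly_to_fls.hom_mult poly_to_fls.hom_power X poly_to_fls_const
        del: mult_pCons_left)
  also have "fls_X_inv ^ d * fls_X ^ d = (1 :: real fls)" by (simp add: fls_X_inv_X_power)
  finally have *: "fls_X_inv ^ d * fps_to_fls (gf weight)
      = poly_to_fls low_part + (\<Sum>i<length vs. fps_to_fls (path_gf (vs ! i)))" by simp
  have "poly_to_fls (char_poly B) * (\<Sum>i<length vs. fps_to_fls (path_gf (vs ! i)))
      = fls_X_inv * poly_to_fls adj_sum"
    by (simp add: sum_distrib_left resolvent adj_sum_def poly_to_fls.hom_sum)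
  then have "poly_to_fls (char_poly B) * (fls_X_inv ^ d * fps_to_fls (gf weight)) = poly_to_fls numer"
    by (simp add: * distrib_left numer_def poly_to_fls.hom_add poly_to_fls.hom_mult X del: mult_pCons_left)
  then show ?thesis by (simp add: mult_ac)
qed

text \<open>Eliminates G between \<open>expand_char_fun\<close> and \<open>expand_numer\<close>;
  injectivity of \<open>expand\<close> returns to rational functions.\<close>

lemma char_fun_times_numer:
  "char_fun (R_sum fs rs m) * to_fract numer = Z ^ Suc d * to_fract (char_poly B)"
proof -
  have "expand (char_fun (R_sum fs rs m) * to_fract numer)
      = (expand (char_fun (R_sum fs rs m)) * fps_to_fls (gf weight)) * fls_X_inv ^ d * poly_to_fls (char_poly B)"
    by (simp add: expand.hom_mult expand_to_fract expand_numer mult_ac)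
  also have "\<dots> = expand (Z ^ Suc d * to_fract (char_poly B))"
    unfolding expand_char_fun
    by (simp add: expand.hom_mult expand.hom_power expand_Z expand_to_fract)
  finally show ?thesis by (simp only: expand.eq_iff)
qed

text \<open>Every vertex has weight at least 1 and \<open>low_part\<close> is nonnegative, so the
  numerator inherits the lower bound known for the unweighted entry sum.\<close>

lemma numer_ge:
  assumes t: "0 < t" and pos: "0 < poly (char_poly B) t"
    and nonneg: "\<And>i j. i < length vs \<Longrightarrow> j < length vs \<Longrightarrow> 0 \<le> poly (adj_mat (char_poly_matrix B) $$ (i, j)) t"
  shows "t * (\<Sum>i<length vs. \<Sum>j<length vs. poly (adj_mat (char_poly_matrix B) $$ (i, j)) t) \<le> poly numer t"
proof -
  have w: "1 \<le> weight (vs ! k)" if "k < length vs" for k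
  proof -
    have "free (vs ! k)" using nth_mem[OF that] by (simp add: set_vs)
    then show ?thesis using multiplicity_pos[of "vs ! k"] by (simp add: weight_def)
  qed
  have "0 \<le> poly low_part t"
    using t by (auto simp: low_part_def poly_sum gf_nth intro!: sum_nonneg mult_nonneg_nonneg weight_nonneg)
  moreover have "(\<Sum>i<length vs. \<Sum>j<length vs. poly (adj_mat (char_poly_matrix B) $$ (i, j)) t) \<le> poly adj_sum t"
    unfolding adj_sum_def poly_sum poly_mult
  proof (intro sum_mono)
    fix i j assume "i \<in> {..<length vs}" "j \<in> {..<length vs}"
    then show "poly (adj_mat (char_poly_matrix B) $$ (i, j)) t
        \<le> poly (adj_mat (char_poly_matrix B) $$ (i, j)) t * poly [:weight (vs ! j):] t"
      using mult_left_mono[OF w[of j] nonneg[of i j]] by simp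
  qed
  ultimately show ?thesis using t pos by (auto simp: numer_def intro!: add_increasing mult_left_mono)
qed

section \<open>Allowed words, free windows and infinite paths\<close>

lemma occurs_window:
  assumes "x \<in> shift_space (set fs)"
  shows "free (map x [k..<k + n])"
  unfolding free_def
proof (intro ballI notI)
  fix a assume a: "a \<in> set fs" "sublist a (map x [k..<k + n])"
  obtain j where "a = map x [j..<j + length a]" using map_upt_sublist[OF a(2)] by blast
  then have "occurs_in_seq a x" by (auto simp: occurs_in_seq_def)
  then show False using assms a(1) by (auto simp: shift_space_def)
qed

text \<open>No forbidden word is longer than \<open>Suc d\<close>, so each occurrence fits into the
  window starting at the same place.\<close>

lemma shift_spaceI:
  assumes "\<And>k. free (map x [k..<k + Suc d])"
  shows "x \<in> shift_space (set fs)"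
  unfolding shift_space_def
proof (intro CollectI ballI notI)
  fix a assume a: "a \<in> set fs" "occurs_in_seq a x"
  then obtain k where k: "a = map x [k..<k + length a]" by (auto simp: occurs_in_seq_def)
  obtain e where e: "Suc d = length a + e"
    using length_le[of a] a(1) le_Suc_ex by fastforce
  have "[k..<k + Suc d] = [k..<k + length a] @ [k + length a..<k + length a + e]"
    unfolding e add.assoc[symmetric] by (rule upt_add_eq_append) simp
  then have "map x [k..<k + Suc d] = map x [k..<k + length a] @ map x [k + length a..<k + length a + e]"
    by (simp only: map_append)
  also have "map x [k..<k + length a] = a" by (rule k[symmetric])
  finally have "sublist a (map x [k..<k + Suc d])"
    by (metis prefixI prefix_imp_sublist)
  then show False using assms[of k] a(1) by (auto simp: free_def)
qed

lemma allowed_window: "x \<in> shift_space (set fs) \<Longrightarrow> allowed (set fs) (map x [k..<k + n])"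
  by (auto simp: allowed_def occurs_in_seq_def intro!: bexI[of _ x] exI[of _ k])

lemma allowed_free:
  assumes "allowed (set fs) w"
  shows "free w"
proof -
  obtain x k where "x \<in> shift_space (set fs)" "w = map x [k..<k + length w]"
    using assms by (auto simp: allowed_def occurs_in_seq_def)
  then show ?thesis using occurs_window by metis
qed

lemma allowed_in_vs: "allowed (set fs) X \<Longrightarrow> length X = d \<Longrightarrow> X \<in> set vs"
  by (simp add: set_vs words_def allowed_free)

text \<open>Moves the window one place along a sequence containing \<open>X\<close>. This supplies
  the set required by \<open>perron_root_exists\<close>.\<close>

lemma step_from_allowed:
  assumes X: "allowed (set fs) X" "length X = d"
  obtains Y where "allowed (set fs) Y" "length Y = d" "1 \<le> step X Y"
proof -
  obtain x k where x: "x \<in> shift_space (set fs)" "X = map x [k..<k + d]"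
    using X by (auto simp: allowed_def occurs_in_seq_def)
  define Y where "Y = map x [Suc k..<Suc k + d]"
  obtain d' where d': "d = Suc d'" using d_pos by (cases d) auto
  have Y: "Y = map x [Suc k..<Suc k + d'] @ [x (k + d)]" by (simp add: Y_def d')
  have "tl X = butlast Y" unfolding Y x(2) d' map_upt_Suc by simp
  moreover have "X @ [last Y] = map x [k..<k + Suc d]" by (simp add: Y x(2))
  then have "free (X @ [last Y])" using occurs_window[OF x(1)] by metis
  moreover have "X \<noteq> []" using X(2) d_pos by auto
  ultimately have "1 \<le> step X Y" using k_weight_ge_1 by (simp add: step_def)
  moreover have "allowed (set fs) Y" unfolding Y_def by (rule allowed_window[OF x(1)])
  ultimately show ?thesis using that[of Y] by (simp add: Y_def)
qed

text \<open>Put \<open>hd X\<close> in front of a sequence starting with \<open>Y\<close>: the only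
  new window of length \<open>Suc d\<close> is \<open>X @ [last Y]\<close>, which is free.\<close>

lemma allowed_prepend:
  assumes X: "length X = d" and Y: "allowed (set fs) Y" "length Y = d"
    and XY: "tl X = butlast Y" and free: "free (X @ [last Y])"
  shows "allowed (set fs) (X @ [last Y])" "allowed (set fs) X"
proof -
  obtain x k where x: "x \<in> shift_space (set fs)" "Y = map x [k..<k + d]"
    using Y by (auto simp: allowed_def occurs_in_seq_def)
  define y where "y j = (case j of 0 \<Rightarrow> hd X | Suc i \<Rightarrow> x (k + i))" for j
  have y_Suc: "map y [Suc j..<Suc j + n] = map x [k + j..<k + j + n]" for j n
    by (rule nth_equalityI) (auto simp: y_def add_ac simp del: upt_Suc)
  have ne: "X \<noteq> []" "Y \<noteq> []" using X Y d_pos by auto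
  have "X @ [last Y] = hd X # tl X @ [last Y]" using ne by simp
  also have "\<dots> = hd X # Y" using ne by (simp add: XY)
  also have "\<dots> = map y [0..<0 + Suc d]"
    unfolding map_upt_Suc using y_Suc[of 0 d] x(2) by (simp add: y_def)
  finally have eq: "X @ [last Y] = map y [0..<0 + Suc d]" .
  have "y \<in> shift_space (set fs)"
  proof (rule shift_spaceI)
    fix j show "free (map y [j..<j + Suc d])"
    proof (cases j)
      case 0
      then show ?thesis using free eq by simp
    next
      case (Suc i)
      then show ?thesis using occurs_window[OF x(1)] y_Suc by metis
    qed
  qed
  note win = allowed_window[OF this, of 0]
  show "allowed (set fs) (X @ [last Y])" unfolding eq by (rule win)
  have "X = take d (X @ [last Y])" using X by simp
  also have "\<dots> = map y [0..<0 + d]" unfolding eq by (simp add: take_map del: upt_Suc)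
  finally show "allowed (set fs) X" using win by metis
qed

text \<open>The first symbols of the vertices form a sequence whose windows of length
  \<open>Suc d\<close> are the edges of the path.\<close>

lemma allowed_of_infinite_path:
  assumes len: "\<And>i. length (X i) = d" and XX: "\<And>i. tl (X i) = butlast (X (Suc i))"
    and free: "\<And>i. free (X i @ [last (X (Suc i))])"
  shows "allowed (set fs) (X 0)"
proof -
  define x where "x i = hd (X i)" for i
  have ne: "X i \<noteq> []" for i using len[of i] d_pos by auto
  have nth: "j < d \<Longrightarrow> X i ! j = x (i + j)" for i j
  proof (induction j arbitrary: i)
    case 0
    then show ?case using ne by (simp add: x_def hd_conv_nth)
  next
    case (Suc j)
    have "X i ! Suc j = tl (X i) ! j" using Suc.prems len[of i] by (simp add: nth_tl)
    also have "\<dots> = X (Suc i) ! j" unfolding XX using Suc.prems len[of "Suc i"] by (simp add: nth_butlast)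
    finally show ?case using Suc by simp
  qed
  have X: "X i = map x [i..<i + d]" for i
    by (rule nth_equalityI) (auto simp: len nth)
  have "x \<in> shift_space (set fs)"
  proof (rule shift_spaceI)
    fix i
    have "X i @ [last (X (Suc i))] = hd (X i) # butlast (X (Suc i)) @ [last (X (Suc i))]"
      using ne[of i] by (simp flip: XX)
    also have "\<dots> = x i # X (Suc i)" using ne by (simp add: x_def)
    also have "\<dots> = map x [i..<i + Suc d]" by (simp only: map_upt_Suc X[of "Suc i"])
    finally show "free (map x [i..<i + Suc d])" using free[of i] by simp
  qed
  then show ?thesis unfolding X by (rule allowed_window)
qed

text \<open>The matrix \<open>B\<close> is indexed by all words avoiding \<open>fs\<close>, including those that do not extend to an
  infinite sequence. No cycle passes through the latter, so they affect only the eigenvalue \<open>0\<close>.\<close>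

lemma eigenvalue_B_iff:
  assumes ws: "distinct ws" "set ws = allowed_words (set fs) d" and y: "y \<noteq> 0"
  shows "eigenvalue (adjacency_matrix fs rs m (Suc d) ws) y \<longleftrightarrow> eigenvalue B y"
proof -
  let ?A = "adjacency_entry fs rs m (Suc d)"
  have ws_iff: "X \<in> set ws \<longleftrightarrow> allowed (set fs) X \<and> length X = d" for X
    by (simp add: ws(2) allowed_words_def)
  have sub: "set ws \<subseteq> set vs" using allowed_in_vs ws_iff by blast
  have A_step: "?A X Y = step X Y" if "X \<in> set ws" "Y \<in> set ws" for X Y
  proof -
    have "X @ [last Y] \<in> allowed_words (set fs) (Suc d) \<longleftrightarrow> free (X @ [last Y])" if XY: "tl X = butlast Y"
    proof
      assume "X @ [last Y] \<in> allowed_words (set fs) (Suc d)"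
      then show "free (X @ [last Y])" by (simp add: allowed_words_def allowed_free)
    next
      assume "free (X @ [last Y])"
      then have "allowed (set fs) (X @ [last Y])"
        using allowed_prepend(1)[of X Y] XY \<open>X \<in> set ws\<close> \<open>Y \<in> set ws\<close> by (simp add: ws_iff)
      then show "X @ [last Y] \<in> allowed_words (set fs) (Suc d)"
        using \<open>X \<in> set ws\<close> by (simp add: allowed_words_def ws_iff)
    qed
    then show ?thesis by (auto simp: adjacency_entry_def step_def)
  qed
  \<comment> \<open>Predecessors of allowed vertices are allowed, so an eigenvector of the adjacency
    matrix stays one when extended by 0.\<close>
  have closed: "X \<in> set ws" if "X \<in> set vs" "Y \<in> set ws" "step X Y \<noteq> 0" for X Y
  proof -
    have "length X = d" using that(1) by (simp add: set_vs words_def)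
    moreover have "tl X = butlast Y" "free (X @ [last Y])"
      using that(3) by (auto simp: step_def split: if_splits)
    ultimately show ?thesis using allowed_prepend(2) that(2) unfolding ws_iff by blast
  qed
  have "(\<exists>g. (\<exists>X\<in>set ws. g X \<noteq> 0) \<and> (\<forall>X\<in>set ws. (\<Sum>Y\<in>set ws. ?A X Y * g Y) = y * g X))
    \<longleftrightarrow> (\<exists>g. (\<exists>X\<in>set vs. g X \<noteq> 0) \<and> (\<forall>X\<in>set vs. (\<Sum>Y\<in>set vs. step X Y * g Y) = y * g X))"
    (is "(\<exists>g. ?P g) \<longleftrightarrow> (\<exists>g. ?Q g)")
  proof
    assume "\<exists>g. ?P g"
    then obtain g X0 where X0: "X0 \<in> set ws" "g X0 \<noteq> 0"
      and g: "\<And>X. X \<in> set ws \<Longrightarrow> (\<Sum>Y\<in>set ws. ?A X Y * g Y) = y * g X" by blast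
    define g' where "g' X = (if X \<in> set ws then g X else 0)" for X
    have sum: "(\<Sum>Y\<in>set vs. step X Y * g' Y) = (\<Sum>Y\<in>set ws. step X Y * g Y)" for X
      using sub by (intro sum.mono_neutral_cong_right) (auto simp: g'_def)
    have "(\<Sum>Y\<in>set vs. step X Y * g' Y) = y * g' X" if X: "X \<in> set vs" for X
    proof (cases "X \<in> set ws")
      case True
      then have "(\<Sum>Y\<in>set ws. step X Y * g Y) = (\<Sum>Y\<in>set ws. ?A X Y * g Y)"
        by (intro sum.cong) (auto simp: A_step)
      then show ?thesis unfolding sum using g[OF True] True by (simp add: g'_def)
    next
      case False
      then have "step X Y * g Y = 0" if "Y \<in> set ws" for Y using closed[OF X that] by auto
      then have "(\<Sum>Y\<in>set ws. step X Y * g Y) = 0" by (intro sum.neutral) auto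
      then show ?thesis unfolding sum using False by (simp add: g'_def)
    qed
    moreover have "X0 \<in> set vs" "g' X0 \<noteq> 0" using X0 sub by (auto simp: g'_def)
    ultimately show "\<exists>g. ?Q g" by blast
  next
    assume "\<exists>g. ?Q g"
    then obtain g X0 where X0: "X0 \<in> set vs" "g X0 \<noteq> 0"
      and g: "\<And>X. X \<in> set vs \<Longrightarrow> (\<Sum>Y\<in>set vs. step X Y * g Y) = y * g X" by blast
    \<comment> \<open>As \<open>y\<close> is non-zero, each vertex in the support of
      \<open>g\<close> has a successor in the support; iterating yields an infinite path, so the
      vertex is allowed.\<close>
    have supp: "X \<in> set ws" if X: "X \<in> set vs" "g X \<noteq> 0" for X
    proof -
      have "\<exists>Z. Z \<in> set vs \<and> g Z \<noteq> 0 \<and> step Y Z \<noteq> 0" if "Y \<in> set vs \<and> g Y \<noteq> 0" for Y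
      proof (rule ccontr)
        assume "\<not> ?thesis"
        then have "(\<Sum>Z\<in>set vs. step Y Z * g Z) = 0" by (intro sum.neutral) auto
        then show False using g[of Y] that y by simp
      qed
      then have "\<forall>Y. \<exists>Z. Y \<in> set vs \<and> g Y \<noteq> 0 \<longrightarrow> Z \<in> set vs \<and> g Z \<noteq> 0 \<and> step Y Z \<noteq> 0"
        by blast
      from choice[OF this] obtain succ where succ: "\<And>Y. Y \<in> set vs \<and> g Y \<noteq> 0 \<Longrightarrow>
          succ Y \<in> set vs \<and> g (succ Y) \<noteq> 0 \<and> step Y (succ Y) \<noteq> 0" by blast
      define path where "path i = (succ ^^ i) X" for i
      have path: "path i \<in> set vs \<and> g (path i) \<noteq> 0" for i
        by (induction i) (use X succ in \<open>auto simp: path_def\<close>)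
      have step: "step (path i) (path (Suc i)) \<noteq> 0" for i
        using succ[OF path[of i]] by (simp add: path_def)
      have "allowed (set fs) (path 0)"
      proof (rule allowed_of_infinite_path)
        show "length (path i) = d" for i using path[of i] by (simp add: set_vs words_def)
        show "tl (path i) = butlast (path (Suc i))" "free (path i @ [last (path (Suc i))])" for i
          using step[of i] by (auto simp: step_def split: if_splits)
      qed
      then show ?thesis using X by (simp add: path_def ws_iff set_vs words_def)
    qed
    have "(\<Sum>Y\<in>set ws. ?A X Y * g Y) = y * g X" if X: "X \<in> set ws" for X
    proof -
      have "(\<Sum>Y\<in>set ws. ?A X Y * g Y) = (\<Sum>Y\<in>set vs. step X Y * g Y)"
      proof (intro sum.mono_neutral_cong_left ballI)
        show "step X Y * g Y = 0" if "Y \<in> set vs - set ws" for Y using supp[of Y] that by auto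
        show "?A X Y * g Y = step X Y * g Y" if "Y \<in> set ws" for Y using A_step[OF X that] by simp
      qed (use sub in auto)
      then show ?thesis using g[of X] sub X by auto
    qed
    moreover have "X0 \<in> set ws" by (rule supp[OF X0])
    ultimately show "\<exists>g. ?P g" using X0(2) by blast
  qed
  then show ?thesis
    unfolding adjacency_matrix_def B_def
    by (simp add: eigenvalue_mat_list_iff[OF ws(1), of ?A] eigenvalue_mat_list_iff[OF distinct_vs, of step])
qed

lemma perron_root_is_greatest_zero:
  assumes ws: "distinct ws" "set ws = allowed_words (set fs) d" "ws \<noteq> []"
  shows "\<exists>\<theta>. is_perron_root (adjacency_matrix fs rs m (Suc d) ws) \<theta>
    \<and> is_greatest {x. is_zero_of (char_fun (R_sum fs rs m)) x} \<theta>"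
proof -
  let ?n = "length vs"
  \<comment> \<open>The indices of allowed vertices serve as the set \<open>W\<close> of
    \<open>perron_root_exists\<close>.\<close>
  define I where "I = {i. i < ?n \<and> allowed (set fs) (vs ! i)}"
  have index: "\<exists>i\<in>I. vs ! i = X" if "allowed (set fs) X" "length X = d" for X
    using allowed_in_vs[OF that] that by (auto simp: I_def in_set_conv_nth)
  have len: "length (vs ! i) = d" if "i < ?n" for i
    using nth_mem[OF that] by (simp add: set_vs words_def)
  obtain \<theta> where \<theta>: "1 \<le> \<theta>" "poly (char_poly B) \<theta> = 0"
    "\<And>t. \<theta> < t \<Longrightarrow> 0 < poly (char_poly B) t"
    "\<And>t i j. \<theta> < t \<Longrightarrow> i < ?n \<Longrightarrow> j < ?n \<Longrightarrow> 0 \<le> poly (adj_mat (char_poly_matrix B) $$ (i, j)) t"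
  proof (rule perron_root_exists[OF B_carrier, of I])
    show "0 \<le> B $$ (i, j)" if "i < ?n" "j < ?n" for i j
      using that by (simp add: B_def step_nonneg)
    show "I \<subseteq> {..<?n}" by (auto simp: I_def)
    obtain X where "X \<in> set ws" using ws(3) by (cases ws) auto
    then show "I \<noteq> {}" using index[of X] ws(2) by (auto simp: allowed_words_def)
    show "\<exists>j\<in>I. 1 \<le> B $$ (i, j)" if i: "i \<in> I" for i
    proof -
      have X: "i < ?n" "allowed (set fs) (vs ! i)" using i by (auto simp: I_def)
      obtain Y where Y: "allowed (set fs) Y" "length Y = d" "1 \<le> step (vs ! i) Y"
        using step_from_allowed[OF X(2) len[OF X(1)]] by blast
      obtain j where "j \<in> I" "vs ! j = Y" using index[OF Y(1,2)] by blast
      then show ?thesis using X(1) Y(3) by (intro bexI[of _ j]) (auto simp: B_def I_def)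
    qed
  qed blast
  have ev: "eigenvalue B t \<longleftrightarrow> poly (char_poly B) t = 0" for t
    by (rule eigenvalue_root_char_poly[OF B_carrier])
  have "is_perron_root (adjacency_matrix fs rs m (Suc d) ws) \<theta>"
    unfolding is_perron_root_def is_greatest_def
  proof (intro conjI ballI)
    \<comment> \<open>Since \<open>1 \<le> \<theta>\<close>, only non-zero eigenvalues are compared
      here and below, where both matrices agree.\<close>
    show "\<theta> \<in> {x. eigenvalue (adjacency_matrix fs rs m (Suc d) ws) x}"
      using \<theta>(1,2) eigenvalue_B_iff[OF ws(1,2), of \<theta>] ev by simp
    fix y assume y: "y \<in> {x. eigenvalue (adjacency_matrix fs rs m (Suc d) ws) x}"
    show "y \<le> \<theta>"
    proof (rule ccontr)
      assume "\<not> y \<le> \<theta>"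
      then have "poly (char_poly B) y = 0" using y \<theta>(1) eigenvalue_B_iff[OF ws(1,2), of y] ev by simp
      then show False using \<theta>(3)[of y] \<open>\<not> y \<le> \<theta>\<close> by simp
    qed
  qed
  moreover have "is_greatest {x. is_zero_of (char_fun (R_sum fs rs m)) x} \<theta>"
  proof (rule is_greatest_zeroI[OF char_fun_times_numer \<theta>(1) \<theta>(3)])
    fix t assume t: "\<theta> < t"
    let ?s = "\<Sum>i<?n. \<Sum>j<?n. poly (adj_mat (char_poly_matrix B) $$ (i, j)) t"
    have "poly (char_poly B) t \<le> (t - \<theta>) * ?s"
      using char_poly_le_adj_sum[OF B_carrier _ t \<theta>(4)[OF t]] ev \<theta>(2) by blast
    then have "t * poly (char_poly B) t \<le> t * ((t - \<theta>) * ?s)"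
      using t \<theta>(1) by (intro mult_left_mono) auto
    also have "\<dots> = (t - \<theta>) * (t * ?s)" by (simp only: mult.left_commute)
    also have "\<dots> \<le> (t - \<theta>) * poly numer t"
      using t \<theta>(1) numer_ge[OF _ \<theta>(3)[OF t] \<theta>(4)[OF t]] by (intro mult_left_mono) auto
    finally show "t * poly (char_poly B) t \<le> (t - \<theta>) * poly numer t" .
  qed
  ultimately show ?thesis by blast
qed

end

section \<open>From the data of the theorem to the transfer system\<close>

theorem theorem5p1:
  fixes fs rs ws :: "('a::finite) list list"
    and m :: "nat \<Rightarrow> nat"
    and p :: nat
    and A :: "real mat"
    and \<Phi> \<Psi> :: ratfun
  assumes q: "CARD('a) \<ge> 2"
    and F_distinct: "distinct fs"
    and F_reduced: "reduced (set fs)"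
    and F_length: "\<forall>a\<in>set fs. length a \<ge> 2"
    and symbols_allowed: "\<forall>c::'a. allowed (set fs) [c]"
    and F_irreducible: "irreducible_shift (set fs)"
    and R_distinct: "distinct rs"
    and R_reduced: "reduced (set rs)"
    and R_allowed: "\<forall>r\<in>set rs. allowed (set fs) r"
    and R_mult: "\<forall>i<length rs. m i \<ge> 2"
    and FR_reduced: "reduced (set fs \<union> set rs)"
    and FR_nonempty: "set fs \<union> set rs \<noteq> {}"
    and p: "p = Max (length ` (set fs \<union> set rs))" "p \<ge> 2"
    and ws: "distinct ws" "set ws = allowed_words (set fs) (p - 1)"
  defines "A \<equiv> adjacency_matrix fs rs m p ws"
    and "\<Phi> \<equiv> Z - of_nat CARD('a) + Z * (\<Sum>i<length rs. defect m i * R_sum fs rs m i)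
                - Z * (\<Sum>j<length fs. R_sum fs rs m (length rs + j))"
    and "\<Psi> \<equiv> Z - of_nat CARD('a) + Z * (\<Sum>i<length rs. defect m i * S_sum fs rs m i)
                - Z * (\<Sum>j<length fs. S_sum fs rs m (length rs + j))"
  shows "(\<exists>\<theta>. is_perron_root A \<theta> \<and> is_greatest {x. is_zero_of \<Phi> x} \<theta>) \<and> \<Phi> = \<Psi>"
proof -
  obtain d where d: "p = Suc d" "0 < d" using p(2) by (cases p) auto
  have len: "length w \<le> p" if "w \<in> set (rs @ fs)" for w
    unfolding p(1) using that by (intro Max_ge) auto
  \<comment> \<open>An allowed word occurs in a sequence avoiding \<open>fs\<close>, so it is not
    itself forbidden.\<close>
  have disjoint: "set rs \<inter> set fs = {}"
    using R_allowed by (auto simp: allowed_def shift_space_def)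
  \<comment> \<open>The empty word lies in every word, so reducedness forbids it beside a word of
    length \<open>p \<ge> 2\<close>.\<close>
  have "[] \<notin> set (rs @ fs)"
  proof
    assume nil: "[] \<in> set (rs @ fs)"
    have "p \<in> length ` (set fs \<union> set rs)" unfolding p(1) using FR_nonempty by (intro Max_in) auto
    then obtain w where w: "w \<in> set fs \<union> set rs" "length w = p" by auto
    have "[] \<in> set fs \<union> set rs" "[] \<noteq> w" using nil w(2) p(2) by auto
    then have "\<not> sublist [] w" using FR_reduced w(1) unfolding reduced_def by blast
    then show False by simp
  qed
  then have sys: "word_system fs rs m"
    using F_distinct R_distinct disjoint FR_reduced R_mult
    by unfold_locales (auto simp: Un_commute)
  \<comment> \<open>The vertex list is needed before the locale can be interpreted, hence the
    qualified \<open>word_system.free\<close>.\<close>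
  obtain vs :: "'a list list" where vs: "set vs = {w \<in> words d. word_system.free fs w}" "distinct vs"
    using finite_distinct_list[of "{w \<in> words d. word_system.free fs w} :: 'a list set"] by auto
  interpret transfer_system fs rs m d vs
    using sys vs d(2) len
    by (auto simp: transfer_system_def transfer_system_axioms_def d(1))
  \<comment> \<open>The first \<open>d\<close> symbols of any sequence in the shift show that the
    adjacency matrix is not empty.\<close>
  obtain x where x: "x \<in> shift_space (set fs)" using symbols_allowed by (auto simp: allowed_def)
  have ws': "set ws = allowed_words (set fs) d" using ws(2) d(1) by simp
  have "map x [0..<0 + d] \<in> set ws"
    using allowed_window[OF x, of 0 d] by (simp add: ws' allowed_words_def)
  then have "ws \<noteq> []" by auto
  from perron_root_is_greatest_zero[OF ws(1) ws' this]
  have "\<exists>\<theta>. is_perron_root A \<theta> \<and> is_greatest {x. is_zero_of (char_fun (R_sum fs rs m)) x} \<theta>"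
    unfolding A_def d(1) .
  moreover have "\<Phi> = char_fun (R_sum fs rs m)" "\<Psi> = char_fun (S_sum fs rs m)"
    by (simp_all only: \<Phi>_def \<Psi>_def char_fun_def)
  ultimately show ?thesis by (simp add: char_fun_S_sum)
qed

end
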